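(* (In $ZFC$.) $IFS(L[r])$ holds if and only if for every absolutely definable real $r$, every set definable in $L[r]$ is countable.
   Context: $L[r]$ is the class of sets constructible relative to $r$. A subset $r\subseteq\omega$ is absolutely definable if for some $\Pi_1$ formula $\theta(x)$, $\theta(r)$ holds in $V$ and there is exactly one $x$ with $\theta(x)$. A set $x\in L[r]$ is definable in $L[r]$ if for some formula $\varphi(v)$ without parameters, $L[r]\models\exists!v\,\varphi(v)\wedge\varphi(x)$. For a partial order $P\in L[r]$, $G\subseteq P$ is $L[r]$-generic if $G$ meets every dense subset of $P$ belonging to $L[r]$. $IFS(L[r])$ is the schema: if $r$ is an absolutely definable real, then every partial order definable in $L[r]$ has an $L[r]$-generic subset in $V$.
   Formalization: A generic subset G of P is required to be a filter meeting every dense subset of P in L[r], and partial orders are nonempty; without the filter condition G = P is always generic and the equivalence fails, e.g. in V = L. *)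

theory Defs
  imports Main
begin

text \<open>
  The statement is a theorem schema of ZFC: definability in an inner model is expressed by a
  quantifier over formulas of the metatheory. It is rendered semantically, for an arbitrary model of
  first-order ZFC whose universe is a type and whose membership relation is an arbitrary (possibly
  ill-founded) binary relation. Below, \<open>fm\<close> is the type of the formulas of the metatheory.
\<close>

datatype fm = Mem nat nat | Eq nat nat | Neg fm | Imp fm fm | All nat fm

primrec fv :: "fm \<Rightarrow> nat set" where
  "fv (Mem i j) = {i, j}"
| "fv (Eq i j) = {i, j}"
| "fv (Neg \<phi>) = fv \<phi>"
| "fv (Imp \<phi> \<psi>) = fv \<phi> \<union> fv \<psi>"
| "fv (All i \<phi>) = fv \<phi> - {i}"

inductive delta0 :: "fm \<Rightarrow> bool" where
  "delta0 (Mem i j)"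
| "delta0 (Eq i j)"
| "delta0 \<phi> \<Longrightarrow> delta0 (Neg \<phi>)"
| "delta0 \<phi> \<Longrightarrow> delta0 \<psi> \<Longrightarrow> delta0 (Imp \<phi> \<psi>)"
| "i \<noteq> j \<Longrightarrow> delta0 \<phi> \<Longrightarrow> delta0 (All i (Imp (Mem i j) \<phi>))"

inductive pi1 :: "fm \<Rightarrow> bool" where
  "delta0 \<phi> \<Longrightarrow> pi1 \<phi>"
| "pi1 \<phi> \<Longrightarrow> pi1 (All i \<phi>)"

text \<open>
  In the following locale, HOL sets over the universe occur only as extensions of elements of the
  model or as classes given by a first-order condition. Every quantifier inside a set-theoretic
  notion ranges over elements of the model, so these notions are first-order over the model; only
  the schemas and the two definability notions quantify over formulas of the metatheory.
\<close>

locale membership =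
  fixes mem :: "'a \<Rightarrow> 'a \<Rightarrow> bool"  (infix "\<epsilon>" 50)
begin

definition ext :: "'a \<Rightarrow> 'a set" where
  "ext x = {z. z \<epsilon> x}"

text \<open>\<open>sat D \<rho> \<phi>\<close> is satisfaction in the substructure with universe \<open>D\<close>.\<close>

primrec sat :: "'a set \<Rightarrow> (nat \<Rightarrow> 'a) \<Rightarrow> fm \<Rightarrow> bool" where
  "sat D \<rho> (Mem i j) \<longleftrightarrow> \<rho> i \<epsilon> \<rho> j"
| "sat D \<rho> (Eq i j) \<longleftrightarrow> \<rho> i = \<rho> j"
| "sat D \<rho> (Neg \<phi>) \<longleftrightarrow> \<not> sat D \<rho> \<phi>"
| "sat D \<rho> (Imp \<phi> \<psi>) \<longleftrightarrow> (sat D \<rho> \<phi> \<longrightarrow> sat D \<rho> \<psi>)"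
| "sat D \<rho> (All i \<phi>) \<longleftrightarrow> (\<forall>a\<in>D. sat D (\<rho>(i := a)) \<phi>)"

definition is_empty :: "'a \<Rightarrow> bool" where
  "is_empty x \<longleftrightarrow> ext x = {}"

definition is_succ :: "'a \<Rightarrow> 'a \<Rightarrow> bool" where
  "is_succ y x \<longleftrightarrow> ext y = insert x (ext x)"


subsection \<open>ZFC\<close>

definition extensionality :: bool where
  "extensionality \<longleftrightarrow> (\<forall>x y. ext x = ext y \<longrightarrow> x = y)"

definition foundation :: bool where
  "foundation \<longleftrightarrow> (\<forall>x. ext x \<noteq> {} \<longrightarrow> (\<exists>y. y \<epsilon> x \<and> ext y \<inter> ext x = {}))"

definition pairing :: bool where
  "pairing \<longleftrightarrow> (\<forall>x y. \<exists>z. ext z = {x, y})"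

definition union :: bool where
  "union \<longleftrightarrow> (\<forall>x. \<exists>u. ext u = {z. \<exists>y. y \<epsilon> x \<and> z \<epsilon> y})"

definition powerset :: bool where
  "powerset \<longleftrightarrow> (\<forall>x. \<exists>p. ext p = {z. ext z \<subseteq> ext x})"

definition infinity :: bool where
  "infinity \<longleftrightarrow>
     (\<exists>w. (\<exists>e. is_empty e \<and> e \<epsilon> w) \<and> (\<forall>x. x \<epsilon> w \<longrightarrow> (\<exists>y. is_succ y x \<and> y \<epsilon> w)))"

definition separation :: bool where
  "separation \<longleftrightarrow> (\<forall>\<phi> \<rho> x. \<exists>y. ext y = {z. z \<epsilon> x \<and> sat UNIV (\<rho>(0 := z)) \<phi>})"

definition replacement :: bool where
  "replacement \<longleftrightarrow>
     (\<forall>\<phi> \<rho> x. (\<forall>u. u \<epsilon> x \<longrightarrow> (\<exists>!v. sat UNIV (\<rho>(0 := u, 1 := v)) \<phi>)) \<longrightarrow>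
        (\<exists>y. ext y = {v. \<exists>u. u \<epsilon> x \<and> sat UNIV (\<rho>(0 := u, 1 := v)) \<phi>}))"

definition choice :: bool where
  "choice \<longleftrightarrow>
     (\<forall>x. (\<forall>y. y \<epsilon> x \<longrightarrow> ext y \<noteq> {}) \<and>
          (\<forall>y z. y \<epsilon> x \<longrightarrow> z \<epsilon> x \<longrightarrow> y \<noteq> z \<longrightarrow> ext y \<inter> ext z = {}) \<longrightarrow>
          (\<exists>c. \<forall>y. y \<epsilon> x \<longrightarrow> (\<exists>!z. z \<epsilon> c \<and> z \<epsilon> y)))"

definition ZFC :: bool where
  "ZFC \<longleftrightarrow> extensionality \<and> foundation \<and> pairing \<and> union \<and> powerset \<and> infinity \<and>
     separation \<and> replacement \<and> choice"


subsection \<open>Ordinals, functions, countability\<close>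

text \<open>Given foundation, an ordinal is a transitive set of transitive sets.\<close>

definition transitive :: "'a \<Rightarrow> bool" where
  "transitive x \<longleftrightarrow> (\<forall>y. y \<epsilon> x \<longrightarrow> ext y \<subseteq> ext x)"

definition ordinal :: "'a \<Rightarrow> bool" where
  "ordinal x \<longleftrightarrow> transitive x \<and> (\<forall>y. y \<epsilon> x \<longrightarrow> transitive y)"

definition limit :: "'a \<Rightarrow> bool" where
  "limit x \<longleftrightarrow> ordinal x \<and> \<not> is_empty x \<and> (\<nexists>y. is_succ x y)"

text \<open>The class of natural numbers of the model, which may contain nonstandard elements.\<close>

definition Omega :: "'a set" where
  "Omega = {n. ordinal n \<and> (\<forall>m. m = n \<or> m \<epsilon> n \<longrightarrow> is_empty m \<or> (\<exists>k. is_succ m k))}"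

definition real :: "'a \<Rightarrow> bool" where
  "real r \<longleftrightarrow> ext r \<subseteq> Omega"

definition is_opair :: "'a \<Rightarrow> 'a \<Rightarrow> 'a \<Rightarrow> bool" where
  "is_opair p a b \<longleftrightarrow> (\<exists>u v. ext p = {u, v} \<and> ext u = {a} \<and> ext v = {a, b})"

text \<open>For a relation \<open>f\<close> of the model, \<open>rel f a b\<close> says that it contains the pair of \<open>a\<close> and \<open>b\<close>.\<close>

definition rel :: "'a \<Rightarrow> 'a \<Rightarrow> 'a \<Rightarrow> bool" where
  "rel f a b \<longleftrightarrow> (\<exists>p. p \<epsilon> f \<and> is_opair p a b)"

definition is_function :: "'a \<Rightarrow> 'a set \<Rightarrow> 'a set \<Rightarrow> bool" where
  "is_function f X Y \<longleftrightarrow>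
     (\<forall>p. p \<epsilon> f \<longrightarrow> (\<exists>a\<in>X. \<exists>b\<in>Y. is_opair p a b)) \<and> (\<forall>a\<in>X. \<exists>!b. rel f a b)"

definition countable :: "'a \<Rightarrow> bool" where
  "countable x \<longleftrightarrow>
     (\<exists>f. is_function f (ext x) Omega \<and> (\<forall>a b c. rel f a c \<longrightarrow> rel f b c \<longrightarrow> a = b))"


subsection \<open>Relative constructibility\<close>

text \<open>
  The successor step of the hierarchy takes the subsets of \<open>A\<close> definable with parameters over
  the structure consisting of \<open>A\<close>, membership and the unary predicate \<open>r \<inter> A\<close>. Here the formulas are
  those of the model, which may be nonstandard, so \<open>fm\<close> cannot be used. As in Kunen's treatment of
  definability, the relations defined by the formulas of the model are instead obtained as the least
  family (in the sense of the model) containing the atomic relations and closed under complement,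
  intersection and projection. A relation is a set of assignments, that is, of functions from the
  natural numbers of the model into \<open>A\<close>.
\<close>

definition assignment :: "'a \<Rightarrow> 'a \<Rightarrow> bool" where
  "assignment A s \<longleftrightarrow> is_function s Omega (ext A)"

definition is_update :: "'a \<Rightarrow> 'a \<Rightarrow> 'a \<Rightarrow> 'a \<Rightarrow> 'a \<Rightarrow> bool" where
  "is_update A s i a t \<longleftrightarrow>
     assignment A t \<and> rel t i a \<and> (\<forall>j\<in>Omega. j \<noteq> i \<longrightarrow> (\<forall>b. rel t j b \<longleftrightarrow> rel s j b))"

definition definability_closed :: "'a \<Rightarrow> 'a \<Rightarrow> 'a \<Rightarrow> bool" where
  "definability_closed r A F \<longleftrightarrow>
     (\<forall>R. \<forall>i\<in>Omega. \<forall>j\<in>Omega.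
        ext R = {s. assignment A s \<and> (\<exists>a b. rel s i a \<and> rel s j b \<and> a \<epsilon> b)} \<longrightarrow> R \<epsilon> F) \<and>
     (\<forall>R. \<forall>i\<in>Omega. \<forall>j\<in>Omega.
        ext R = {s. assignment A s \<and> (\<exists>a. rel s i a \<and> rel s j a)} \<longrightarrow> R \<epsilon> F) \<and>
     (\<forall>R. \<forall>i\<in>Omega.
        ext R = {s. assignment A s \<and> (\<exists>a. rel s i a \<and> a \<epsilon> r)} \<longrightarrow> R \<epsilon> F) \<and>
     (\<forall>R S. S \<epsilon> F \<longrightarrow> ext R = {s. assignment A s \<and> \<not> s \<epsilon> S} \<longrightarrow> R \<epsilon> F) \<and>
     (\<forall>R S T. S \<epsilon> F \<longrightarrow> T \<epsilon> F \<longrightarrow> ext R = ext S \<inter> ext T \<longrightarrow> R \<epsilon> F) \<and>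
     (\<forall>R S. \<forall>i\<in>Omega. S \<epsilon> F \<longrightarrow>
        ext R = {s. assignment A s \<and> (\<exists>a t. a \<epsilon> A \<and> is_update A s i a t \<and> t \<epsilon> S)} \<longrightarrow> R \<epsilon> F)"

definition definable_relation :: "'a \<Rightarrow> 'a \<Rightarrow> 'a \<Rightarrow> bool" where
  "definable_relation r A R \<longleftrightarrow> (\<forall>F. definability_closed r A F \<longrightarrow> R \<epsilon> F)"

text \<open>
  The assignment \<open>s\<close> supplies the parameters. The empty set is listed separately because there are
  no assignments into an empty \<open>A\<close>.
\<close>

definition definable_subset :: "'a \<Rightarrow> 'a \<Rightarrow> 'a \<Rightarrow> bool" where
  "definable_subset r A X \<longleftrightarrow>
     is_empty X \<or>
     (\<exists>R s. \<exists>i\<in>Omega. definable_relation r A R \<and> assignment A s \<and>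
        ext X = {a. a \<epsilon> A \<and> (\<exists>t. is_update A s i a t \<and> t \<epsilon> R)})"

text \<open>\<open>f\<close> is the sequence of the levels \<open>L\<^sub>\<beta>[r]\<close> for \<open>\<beta> \<le> \<alpha>\<close>.\<close>

definition is_hierarchy :: "'a \<Rightarrow> 'a \<Rightarrow> 'a \<Rightarrow> bool" where
  "is_hierarchy r \<alpha> f \<longleftrightarrow>
     ordinal \<alpha> \<and> is_function f (insert \<alpha> (ext \<alpha>)) UNIV \<and>
     (\<forall>\<beta> v. rel f \<beta> v \<longrightarrow>
        (is_empty \<beta> \<longrightarrow> is_empty v) \<and>
        (\<forall>\<gamma> u. is_succ \<beta> \<gamma> \<longrightarrow> rel f \<gamma> u \<longrightarrow> ext v = {X. definable_subset r u X}) \<and>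
        (limit \<beta> \<longrightarrow> ext v = {X. \<exists>\<gamma> u. \<gamma> \<epsilon> \<beta> \<and> rel f \<gamma> u \<and> X \<epsilon> u}))"

definition L :: "'a \<Rightarrow> 'a set" where
  "L r = {x. \<exists>\<alpha> f v. is_hierarchy r \<alpha> f \<and> rel f \<alpha> v \<and> x \<epsilon> v}"


subsection \<open>Definability and generic sets\<close>

text \<open>
  The free variables of the formulas are contained in \<open>{0}\<close>, so the constant assignments below
  only fix the value of that variable.
\<close>

definition absolutely_definable :: "'a \<Rightarrow> bool" where
  "absolutely_definable r \<longleftrightarrow> real r \<and>
     (\<exists>\<theta>. pi1 \<theta> \<and> fv \<theta> \<subseteq> {0} \<and> sat UNIV (\<lambda>_. r) \<theta> \<and> (\<exists>!x. sat UNIV (\<lambda>_. x) \<theta>))"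

definition definable_in :: "'a set \<Rightarrow> 'a \<Rightarrow> bool" where
  "definable_in D x \<longleftrightarrow> x \<in> D \<and>
     (\<exists>\<phi>. fv \<phi> \<subseteq> {0} \<and> (\<exists>!v. v \<in> D \<and> sat D (\<lambda>_. v) \<phi>) \<and> sat D (\<lambda>_. x) \<phi>)"

text \<open>As usual in forcing, partial orders are nonempty.\<close>

definition is_partial_order :: "'a \<Rightarrow> 'a \<Rightarrow> bool" where
  "is_partial_order P le \<longleftrightarrow>
     \<not> is_empty P \<and>
     (\<forall>z. z \<epsilon> le \<longrightarrow> (\<exists>p q. p \<epsilon> P \<and> q \<epsilon> P \<and> is_opair z p q)) \<and>
     (\<forall>p. p \<epsilon> P \<longrightarrow> rel le p p) \<and>
     (\<forall>p q. rel le p q \<longrightarrow> rel le q p \<longrightarrow> p = q) \<and>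
     (\<forall>p q s. rel le p q \<longrightarrow> rel le q s \<longrightarrow> rel le p s)"

definition dense :: "'a \<Rightarrow> 'a \<Rightarrow> 'a \<Rightarrow> bool" where
  "dense P le D \<longleftrightarrow> ext D \<subseteq> ext P \<and> (\<forall>p. p \<epsilon> P \<longrightarrow> (\<exists>q. q \<epsilon> D \<and> rel le q p))"

definition filter :: "'a \<Rightarrow> 'a \<Rightarrow> 'a \<Rightarrow> bool" where
  "filter P le G \<longleftrightarrow>
     ext G \<subseteq> ext P \<and> \<not> is_empty G \<and>
     (\<forall>p q. p \<epsilon> G \<longrightarrow> rel le p q \<longrightarrow> q \<epsilon> G) \<and>
     (\<forall>p q. p \<epsilon> G \<longrightarrow> q \<epsilon> G \<longrightarrow> (\<exists>s. s \<epsilon> G \<and> rel le s p \<and> rel le s q))"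

text \<open>
  Generic sets are filters. Without this requirement \<open>P\<close> itself would meet all its dense subsets.
\<close>

definition generic :: "'a set \<Rightarrow> 'a \<Rightarrow> 'a \<Rightarrow> 'a \<Rightarrow> bool" where
  "generic M P le G \<longleftrightarrow>
     filter P le G \<and> (\<forall>D\<in>M. dense P le D \<longrightarrow> ext G \<inter> ext D \<noteq> {})"

text \<open>A definable partial order is a definable ordered pair of a set and its order relation.\<close>

definition IFS :: bool where
  "IFS \<longleftrightarrow>
     (\<forall>r. absolutely_definable r \<longrightarrow>
        (\<forall>z P le. definable_in (L r) z \<longrightarrow> is_opair z P le \<longrightarrow> is_partial_order P le \<longrightarrow>
           (\<exists>G. generic (L r) P le G)))"

end

end

theory Submission
  imports Defs
begin

text \<open>
  If \<open>x\<close> is definable in \<open>L[r]\<close>, then so is the poset of partial functions from a natural number into \<open>x\<close>; a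
  generic filter meets the set of the conditions with \<open>a\<close> in their range, for each \<open>a \<in> x\<close>, and hence
  yields a partial surjection from the natural numbers onto \<open>x\<close>. Conversely, if \<open>P\<close> is definable in
  \<open>L[r]\<close>, then so are its carrier and the power set of the carrier as computed in \<open>L[r]\<close>. If both
  are countable, a descending sequence of conditions through the dense sets of \<open>L[r]\<close> generates a
  generic filter.

  Since the model may be ill-founded, recursion and definability have to be carried out inside it.
  The predicate \<open>dfb\<close> below collects the conditions that are given by a formula of the metatheory; its
  closure rules replace writing down formulas.
\<close>

subsection \<open>Conditions given by formulas\<close>

text \<open>What has to be known about \<open>L[r]\<close> is kept small. The sets built there (the
  poset of partial functions, its order, the dense sets, the power set of the carrier) are all cut
  out by bounded conditions, which mean the same in every transitive class containing the
  parameters; this takes the place of a proof that \<open>L[r]\<close> satisfies ZFC. Two kinds of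
  formulas have to be reconciled. Separation, replacement and definability in \<open>L[r]\<close>
  refer to formulas of the metatheory, while the levels of the hierarchy are built from formulas in
  the sense of the model. It suffices that each metatheoretic formula is imitated by an internal
  definable relation. The power set enters because a dense set in \<open>L[r]\<close> need not
  itself be definable there: the one definable set that collects them all is what the countability
  hypothesis can be applied to. A descending sequence indexed by \<open>nat\<close> would miss the
  nonstandard naturals of the model, and choosing its members freely would not yield a set of the
  model. Hence each choice is made by least number under a given injection into the
  naturals.\<close>

lemma finite_fv: "finite (fv \<phi>)"
  by (induction \<phi>) auto

context membership
begin

section \<open>Satisfaction under change of assignment and renaming of variables\<close>

lemma sat_cong: "\<forall>i\<in>fv \<phi>. \<rho> i = \<rho>' i \<Longrightarrow> sat D \<rho> \<phi> \<longleftrightarrow> sat D \<rho>' \<phi>"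
proof (induction \<phi> arbitrary: \<rho> \<rho>')
  case (Imp \<phi> \<psi>)
  from Imp.IH[of \<rho> \<rho>'] Imp.prems show ?case by simp
next
  case (All k \<phi>)
  from All.prems have "sat D (\<rho>(k := a)) \<phi> \<longleftrightarrow> sat D (\<rho>'(k := a)) \<phi>" for a
    by (intro All.IH) simp
  then show ?case by simp
next
  case (Neg \<phi>)
  from Neg.IH[of \<rho> \<rho>'] Neg.prems show ?case by simp
qed simp_all

text \<open>The map \<open>f\<close> may identify variables, so a bound variable cannot simply be
  sent along it; it goes to a variable outside the image of the free ones, which avoids
  capture.\<close>

lemma sat_rename: "\<exists>\<psi>. fv \<psi> \<subseteq> f ` fv \<phi> \<and> (\<forall>\<rho>. sat D \<rho> \<psi> \<longleftrightarrow> sat D (\<lambda>n. \<rho> (f n)) \<phi>)"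
proof (induction \<phi> arbitrary: f)
  case (Mem i j)
  show ?case by (rule exI[of _ "Mem (f i) (f j)"]) auto
next
  case (Eq i j)
  show ?case by (rule exI[of _ "Eq (f i) (f j)"]) auto
next
  case (Neg \<phi>)
  from Neg[of f] obtain \<psi> where "fv \<psi> \<subseteq> f ` fv \<phi>" "\<forall>\<rho>. sat D \<rho> \<psi> \<longleftrightarrow> sat D (\<lambda>n. \<rho> (f n)) \<phi>"
    by blast
  then show ?case by (intro exI[of _ "Neg \<psi>"]) simp
next
  case (Imp \<phi> \<phi>')
  from Imp(1)[of f] obtain \<psi> where 1: "fv \<psi> \<subseteq> f ` fv \<phi>" "\<forall>\<rho>. sat D \<rho> \<psi> \<longleftrightarrow> sat D (\<lambda>n. \<rho> (f n)) \<phi>"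
    by blast
  from Imp(2)[of f] obtain \<psi>' where 2: "fv \<psi>' \<subseteq> f ` fv \<phi>'" "\<forall>\<rho>. sat D \<rho> \<psi>' \<longleftrightarrow> sat D (\<lambda>n. \<rho> (f n)) \<phi>'"
    by blast
  from 1 2 show ?case by (intro exI[of _ "Imp \<psi> \<psi>'"]) auto
next
  case (All i \<phi>)
  have "finite (f ` fv \<phi>)" by (simp add: finite_fv)
  then obtain k where k: "k \<notin> f ` fv \<phi>" using ex_new_if_finite infinite_UNIV_nat by blast
  from All[of "f(i := k)"] obtain \<psi> where \<psi>: "fv \<psi> \<subseteq> (f(i := k)) ` fv \<phi>"
    "\<forall>\<rho>. sat D \<rho> \<psi> \<longleftrightarrow> sat D (\<lambda>n. \<rho> ((f(i := k)) n)) \<phi>" by blast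
  have "sat D (\<lambda>n. (\<rho>(k := a)) ((f(i := k)) n)) \<phi> \<longleftrightarrow> sat D ((\<lambda>n. \<rho> (f n))(i := a)) \<phi>" for \<rho> a
    by (rule sat_cong) (use k in auto)
  with \<psi> show ?case by (intro exI[of _ "All k \<psi>"]) auto
qed

text \<open>Terms are functions of the assignment rather than syntax, so that conditions can be
  arbitrary HOL predicates and the closure rules apply by unification.\<close>

definition trm :: "'a set \<Rightarrow> ((nat \<Rightarrow> 'a) \<Rightarrow> 'a) \<Rightarrow> bool" where
  "trm C t \<longleftrightarrow> (\<exists>i. t = (\<lambda>\<rho>. \<rho> i)) \<or> (\<exists>c\<in>C. t = (\<lambda>_. c))"

definition trans_class :: "'a set \<Rightarrow> bool" where
  "trans_class D \<longleftrightarrow> (\<forall>x\<in>D. ext x \<subseteq> D)"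

text \<open>
  The transitivity of \<open>D\<close> is a premise inside the definition so that the closure rules are
  unconditional; it lets bounded quantifiers range over the whole universe.
\<close>

definition dfb :: "'a set \<Rightarrow> 'a set \<Rightarrow> ((nat \<Rightarrow> 'a) \<Rightarrow> bool) \<Rightarrow> bool" where
  "dfb C D P \<longleftrightarrow> (C \<subseteq> D \<and> trans_class D \<longrightarrow>
     (\<exists>\<phi> \<tau>. (\<forall>n. trm C (\<tau> n)) \<and> (\<forall>\<rho>. range \<rho> \<subseteq> D \<longrightarrow> (P \<rho> \<longleftrightarrow> sat D (\<lambda>n. \<tau> n \<rho>) \<phi>))))"

section \<open>Closure rules for conditions given by formulas\<close>

lemma trm_var: "trm C (\<lambda>\<rho>. \<rho> i)"
  by (auto simp: trm_def)

lemma trm_const: "c \<in> C \<Longrightarrow> trm C (\<lambda>_. c)"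
  by (auto simp: trm_def)

lemma trm_in: "trm C t \<Longrightarrow> C \<subseteq> D \<Longrightarrow> range \<rho> \<subseteq> D \<Longrightarrow> t \<rho> \<in> D"
  by (auto simp: trm_def)

lemma trm_compose: "trm C t \<Longrightarrow> (\<And>n. trm C (\<tau> n)) \<Longrightarrow> trm C (\<lambda>\<rho>. t (\<lambda>n. \<tau> n \<rho>))"
  by (auto simp: trm_def)

lemma dfb_cong:
  assumes "dfb C D P" "\<And>\<rho>. range \<rho> \<subseteq> D \<Longrightarrow> C \<subseteq> D \<Longrightarrow> trans_class D \<Longrightarrow> P \<rho> \<longleftrightarrow> Q \<rho>"
  shows "dfb C D Q"
  using assms by (auto simp: dfb_def)

lemma trm_mono: "trm C t \<Longrightarrow> C \<subseteq> C' \<Longrightarrow> trm C' t"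
  unfolding trm_def by blast

lemma dfb_mono:
  assumes P: "dfb C D P" and C: "C \<subseteq> C'"
  shows "dfb C' D P"
  unfolding dfb_def
proof
  assume *: "C' \<subseteq> D \<and> trans_class D"
  with C have "C \<subseteq> D \<and> trans_class D" by blast
  with P obtain \<phi> \<tau> where \<phi>: "\<forall>n. trm C (\<tau> n)"
    "\<forall>\<rho>. range \<rho> \<subseteq> D \<longrightarrow> (P \<rho> \<longleftrightarrow> sat D (\<lambda>n. \<tau> n \<rho>) \<phi>)"
    unfolding dfb_def by blast
  show "\<exists>\<phi> \<tau>. (\<forall>n. trm C' (\<tau> n)) \<and> (\<forall>\<rho>. range \<rho> \<subseteq> D \<longrightarrow> (P \<rho> \<longleftrightarrow> sat D (\<lambda>n. \<tau> n \<rho>) \<phi>))"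
    by (intro exI[of _ \<phi>] exI[of _ \<tau>] conjI allI \<phi>(2)[THEN spec]) (rule trm_mono[OF \<phi>(1)[THEN spec] C])
qed

lemma dfb_mem:
  assumes "trm C t" "trm C u"
  shows "dfb C D (\<lambda>\<rho>. t \<rho> \<epsilon> u \<rho>)"
  unfolding dfb_def
  by (intro impI exI[of _ "Mem 0 1"] exI[of _ "\<lambda>n. if n = 0 then t else u"]) (use assms in auto)

lemma dfb_eq:
  assumes "trm C t" "trm C u"
  shows "dfb C D (\<lambda>\<rho>. t \<rho> = u \<rho>)"
  unfolding dfb_def
  by (intro impI exI[of _ "Eq 0 1"] exI[of _ "\<lambda>n. if n = 0 then t else u"]) (use assms in auto)

lemma dfb_not: "dfb C D P \<Longrightarrow> dfb C D (\<lambda>\<rho>. \<not> P \<rho>)"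
  unfolding dfb_def
proof
  assume "C \<subseteq> D \<and> trans_class D \<longrightarrow> (\<exists>\<phi> \<tau>. (\<forall>n. trm C (\<tau> n)) \<and>
      (\<forall>\<rho>. range \<rho> \<subseteq> D \<longrightarrow> (P \<rho> \<longleftrightarrow> sat D (\<lambda>n. \<tau> n \<rho>) \<phi>)))" "C \<subseteq> D \<and> trans_class D"
  then obtain \<phi> \<tau> where "\<forall>n. trm C (\<tau> n)"
    "\<forall>\<rho>. range \<rho> \<subseteq> D \<longrightarrow> (P \<rho> \<longleftrightarrow> sat D (\<lambda>n. \<tau> n \<rho>) \<phi>)" by blast
  then show "\<exists>\<phi> \<tau>. (\<forall>n. trm C (\<tau> n)) \<and>
      (\<forall>\<rho>. range \<rho> \<subseteq> D \<longrightarrow> (\<not> P \<rho> \<longleftrightarrow> sat D (\<lambda>n. \<tau> n \<rho>) \<phi>))"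
    by (intro exI[of _ "Neg \<phi>"] exI[of _ \<tau>]) simp
qed

lemma dfb_imp:
  assumes "dfb C D P" "dfb C D Q"
  shows "dfb C D (\<lambda>\<rho>. P \<rho> \<longrightarrow> Q \<rho>)"
  unfolding dfb_def
proof
  assume *: "C \<subseteq> D \<and> trans_class D"
  with assms(1) obtain \<phi> \<tau> where 1: "\<forall>n. trm C (\<tau> n)"
    "\<forall>\<rho>. range \<rho> \<subseteq> D \<longrightarrow> (P \<rho> \<longleftrightarrow> sat D (\<lambda>n. \<tau> n \<rho>) \<phi>)" unfolding dfb_def by blast
  from * assms(2) obtain \<phi>' \<tau>' where 2: "\<forall>n. trm C (\<tau>' n)"
    "\<forall>\<rho>. range \<rho> \<subseteq> D \<longrightarrow> (Q \<rho> \<longleftrightarrow> sat D (\<lambda>n. \<tau>' n \<rho>) \<phi>')" unfolding dfb_def by blast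
  \<comment> \<open>The two formulas come with separate sequences of terms. Moving one to the even
    and the other to the odd variables lets a single sequence serve both.\<close>
  obtain \<psi> where \<psi>: "\<forall>\<rho>. sat D \<rho> \<psi> \<longleftrightarrow> sat D (\<lambda>n. \<rho> (2 * n)) \<phi>"
    using sat_rename[of "\<lambda>n. 2 * n" \<phi> D] by blast
  obtain \<psi>' where \<psi>': "\<forall>\<rho>. sat D \<rho> \<psi>' \<longleftrightarrow> sat D (\<lambda>n. \<rho> (2 * n + 1)) \<phi>'"
    using sat_rename[of "\<lambda>n. 2 * n + 1" \<phi>' D] by blast
  define \<sigma> where "\<sigma> n = (if even n then \<tau> (n div 2) else \<tau>' (n div 2))" for n
  have [simp]: "\<sigma> (2 * n) = \<tau> n" "\<sigma> (Suc (2 * n)) = \<tau>' n" for n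
    by (simp_all add: \<sigma>_def)
  show "\<exists>\<phi> \<tau>. (\<forall>n. trm C (\<tau> n)) \<and>
      (\<forall>\<rho>. range \<rho> \<subseteq> D \<longrightarrow> ((P \<rho> \<longrightarrow> Q \<rho>) \<longleftrightarrow> sat D (\<lambda>n. \<tau> n \<rho>) \<phi>))"
    by (rule exI[of _ "Imp \<psi> \<psi>'"], rule exI[of _ \<sigma>]) (use 1 2 \<psi> \<psi>' in \<open>auto simp: \<sigma>_def\<close>)
qed

lemma dfb_conj: "dfb C D P \<Longrightarrow> dfb C D Q \<Longrightarrow> dfb C D (\<lambda>\<rho>. P \<rho> \<and> Q \<rho>)"
  using dfb_not[OF dfb_imp[OF _ dfb_not], of C D P Q] by simp

lemma dfb_disj: "dfb C D P \<Longrightarrow> dfb C D Q \<Longrightarrow> dfb C D (\<lambda>\<rho>. P \<rho> \<or> Q \<rho>)"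
  using dfb_imp[OF dfb_not, of C D P Q] by (simp add: disj_imp)

lemma dfb_iff: "dfb C D P \<Longrightarrow> dfb C D Q \<Longrightarrow> dfb C D (\<lambda>\<rho>. P \<rho> \<longleftrightarrow> Q \<rho>)"
  using dfb_conj[OF dfb_imp dfb_imp, of C D P Q Q P] by (simp add: iff_conv_conj_imp)

text \<open>De Bruijn convention: under the quantifier the bound element is \<open>\<rho> 0\<close>
  and the outer assignment is shifted by one.\<close>

lemma dfb_ball:
  assumes "dfb C D (\<lambda>\<rho>. Q (\<lambda>n. \<rho> (Suc n)) (\<rho> 0))"
  shows "dfb C D (\<lambda>\<rho>. \<forall>a\<in>D. Q \<rho> a)"
  unfolding dfb_def
proof
  assume "C \<subseteq> D \<and> trans_class D"
  with assms obtain \<phi> \<tau> where \<phi>: "\<forall>n. trm C (\<tau> n)"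
    "\<forall>\<rho>. range \<rho> \<subseteq> D \<longrightarrow> (Q (\<lambda>n. \<rho> (Suc n)) (\<rho> 0) \<longleftrightarrow> sat D (\<lambda>n. \<tau> n \<rho>) \<phi>)"
    unfolding dfb_def by blast
  \<comment> \<open>Formula variables whose term reads the bound element are merged into variable 0,
    which \<open>All 0\<close> binds; the others move up by one.\<close>
  define f where "f n = (if \<tau> n = (\<lambda>\<rho>. \<rho> 0) then 0 else Suc n)" for n
  obtain \<psi> where \<psi>: "\<forall>\<rho>. sat D \<rho> \<psi> \<longleftrightarrow> sat D (\<lambda>n. \<rho> (f n)) \<phi>"
    using sat_rename[of f \<phi> D] by blast
  \<comment> \<open>The entries \<open>\<lambda>\<rho>. \<rho> 0\<close> are placeholders that are
    never consulted. Prepending \<open>undefined\<close> undoes the index shift, and is harmless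
    because the terms in that branch do not read position 0.\<close>
  define \<sigma> where "\<sigma> = case_nat (\<lambda>\<rho>. \<rho> 0)
    (\<lambda>n. if \<tau> n = (\<lambda>\<rho>. \<rho> 0) then (\<lambda>\<rho>. \<rho> 0) else (\<lambda>\<rho>. \<tau> n (case_nat undefined \<rho>)))"
  have \<sigma>: "trm C (\<sigma> n)" for n
  proof (cases n)
    case 0
    then show ?thesis by (simp add: \<sigma>_def trm_var)
  next
    case (Suc k)
    have "trm C (\<tau> k)" using \<phi> by simp
    then consider "\<tau> k = (\<lambda>\<rho>. \<rho> 0)" | i where "\<tau> k = (\<lambda>\<rho>. \<rho> (Suc i))" | c where "c \<in> C" "\<tau> k = (\<lambda>_. c)"
      unfolding trm_def by (metis not0_implies_Suc)
    then show ?thesis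
    proof cases
      case 1
      then show ?thesis by (simp add: Suc \<sigma>_def trm_var)
    next
      case 2
      show ?thesis
      \<comment> \<open>Different variables are equal as functions when the universe has a single
        element, so this case cannot be dismissed.\<close>
      proof (cases "\<tau> k = (\<lambda>\<rho>. \<rho> 0)")
        case False
        then have "\<sigma> n = (\<lambda>\<rho>. \<tau> k (case_nat undefined \<rho>))" by (simp add: Suc \<sigma>_def)
        also have "\<dots> = (\<lambda>\<rho>. \<rho> i)" using 2 by simp
        finally show ?thesis by (simp add: trm_var)
      qed (simp add: Suc \<sigma>_def trm_var)
    next
      case 3
      then show ?thesis by (auto simp: Suc \<sigma>_def trm_var trm_const)
    qed
  qed
  have eq: "((\<lambda>n. \<sigma> n \<rho>)(0 := a)) (f n) = \<tau> n (case_nat a \<rho>)" for \<rho> a n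
  proof (cases "\<tau> n = (\<lambda>\<rho>. \<rho> 0)")
    case False
    have "trm C (\<tau> n)" using \<phi> by simp
    with False consider i where "\<tau> n = (\<lambda>\<rho>. \<rho> (Suc i))" | c where "\<tau> n = (\<lambda>_. c)"
      unfolding trm_def by (metis not0_implies_Suc)
    then show ?thesis using False by cases (simp_all add: f_def \<sigma>_def)
  qed (simp add: f_def)
  have "(\<forall>a\<in>D. Q \<rho> a) \<longleftrightarrow> sat D (\<lambda>n. \<sigma> n \<rho>) (All 0 \<psi>)" if "range \<rho> \<subseteq> D" for \<rho>
  proof -
    have "Q \<rho> a \<longleftrightarrow> sat D ((\<lambda>n. \<sigma> n \<rho>)(0 := a)) \<psi>" if "a \<in> D" for a
    proof -
      have "range (case_nat a \<rho>) \<subseteq> D"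
        using that \<open>range \<rho> \<subseteq> D\<close> by (auto simp: image_subset_iff split: nat.split)
      with \<phi>(2) have "Q \<rho> a \<longleftrightarrow> sat D (\<lambda>n. \<tau> n (case_nat a \<rho>)) \<phi>"
        by (auto dest!: spec[of _ "case_nat a \<rho>"])
      then show ?thesis using \<psi> by (simp only: eq)
    qed
    then show ?thesis by simp
  qed
  with \<sigma> show "\<exists>\<phi> \<tau>. (\<forall>n. trm C (\<tau> n)) \<and>
      (\<forall>\<rho>. range \<rho> \<subseteq> D \<longrightarrow> ((\<forall>a\<in>D. Q \<rho> a) \<longleftrightarrow> sat D (\<lambda>n. \<tau> n \<rho>) \<phi>))"
    by blast
qed

lemma dfb_bex:
  assumes "dfb C D (\<lambda>\<rho>. Q (\<lambda>n. \<rho> (Suc n)) (\<rho> 0))"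
  shows "dfb C D (\<lambda>\<rho>. \<exists>a\<in>D. Q \<rho> a)"
  using dfb_not[OF dfb_ball[of C D "\<lambda>\<rho> a. \<not> Q \<rho> a"], OF dfb_not, OF assms] by simp

lemma dfb_all: "dfb C UNIV (\<lambda>\<rho>. Q (\<lambda>n. \<rho> (Suc n)) (\<rho> 0)) \<Longrightarrow> dfb C UNIV (\<lambda>\<rho>. \<forall>a. Q \<rho> a)"
  using dfb_ball[of C UNIV Q] by simp

lemma dfb_ex: "dfb C UNIV (\<lambda>\<rho>. Q (\<lambda>n. \<rho> (Suc n)) (\<rho> 0)) \<Longrightarrow> dfb C UNIV (\<lambda>\<rho>. \<exists>a. Q \<rho> a)"
  using dfb_bex[of C UNIV Q] by simp

text \<open>With this a notion needs to be analysed only once, at variables; the instances for one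
  to five arguments then allow parameters and other variables in its place.\<close>

lemma dfb_subst:
  assumes "dfb C D P" "\<And>n. trm C (\<tau> n)"
  shows "dfb C D (\<lambda>\<rho>. P (\<lambda>n. \<tau> n \<rho>))"
  unfolding dfb_def
proof
  assume *: "C \<subseteq> D \<and> trans_class D"
  with assms obtain \<phi> \<sigma> where \<phi>: "\<forall>n. trm C (\<sigma> n)"
    "\<forall>\<rho>. range \<rho> \<subseteq> D \<longrightarrow> (P \<rho> \<longleftrightarrow> sat D (\<lambda>n. \<sigma> n \<rho>) \<phi>)"
    unfolding dfb_def by blast
  show "\<exists>\<phi> \<tau>'. (\<forall>n. trm C (\<tau>' n)) \<and>
      (\<forall>\<rho>. range \<rho> \<subseteq> D \<longrightarrow> (P (\<lambda>n. \<tau> n \<rho>) \<longleftrightarrow> sat D (\<lambda>n. \<tau>' n \<rho>) \<phi>))"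
  proof (intro exI conjI allI impI)
    show "trm C (\<lambda>\<rho>. \<sigma> n (\<lambda>m. \<tau> m \<rho>))" for n
      by (rule trm_compose) (use \<phi> assms in auto)
    fix \<rho> :: "nat \<Rightarrow> 'a"
    assume "range \<rho> \<subseteq> D"
    then have "range (\<lambda>n. \<tau> n \<rho>) \<subseteq> D" using trm_in[OF assms(2)] * by auto
    then show "P (\<lambda>n. \<tau> n \<rho>) \<longleftrightarrow> sat D (\<lambda>n. \<sigma> n (\<lambda>m. \<tau> m \<rho>)) \<phi>" using \<phi> by blast
  qed
qed

lemma dfb_subst1:
  assumes "dfb C D (\<lambda>\<rho>. P (\<rho> 0))" "trm C t"
  shows "dfb C D (\<lambda>\<rho>. P (t \<rho>))"
  using dfb_subst[OF assms(1), of "\<lambda>n. t"] assms(2) by simp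

lemma dfb_subst2:
  assumes "dfb C D (\<lambda>\<rho>. P (\<rho> 0) (\<rho> 1))" "trm C t" "trm C u"
  shows "dfb C D (\<lambda>\<rho>. P (t \<rho>) (u \<rho>))"
  using dfb_subst[OF assms(1), of "\<lambda>n. if n = 0 then t else u"] assms(2,3) by simp

lemma dfb_subst3:
  assumes "dfb C D (\<lambda>\<rho>. P (\<rho> 0) (\<rho> 1) (\<rho> 2))" "trm C t" "trm C u" "trm C v"
  shows "dfb C D (\<lambda>\<rho>. P (t \<rho>) (u \<rho>) (v \<rho>))"
  using dfb_subst[OF assms(1), of "\<lambda>n. if n = 0 then t else if n = 1 then u else v"] assms(2-)
  by simp

lemma dfb_subst5:
  assumes "dfb C D (\<lambda>\<rho>. P (\<rho> 0) (\<rho> 1) (\<rho> 2) (\<rho> 3) (\<rho> 4))"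
    "trm C t" "trm C u" "trm C v" "trm C w" "trm C x"
  shows "dfb C D (\<lambda>\<rho>. P (t \<rho>) (u \<rho>) (v \<rho>) (w \<rho>) (x \<rho>))"
  using dfb_subst[OF assms(1), of "\<lambda>n. if n = 0 then t else if n = 1 then u else if n = 2 then v
    else if n = 3 then w else x"] assms(2-)
  by simp

text \<open>Elements of a member of a transitive class lie in the class, so a bounded quantifier
  over the universe and its relativization to \<open>D\<close> agree.\<close>

lemma dfb_all_in:
  assumes "trm C t" "dfb C D (\<lambda>\<rho>. Q (\<lambda>n. \<rho> (Suc n)) (\<rho> 0))"
  shows "dfb C D (\<lambda>\<rho>. \<forall>a. a \<epsilon> t \<rho> \<longrightarrow> Q \<rho> a)"
proof (rule dfb_cong)
  have "trm C (\<lambda>\<rho>. t (\<lambda>n. \<rho> (Suc n)))"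
    by (rule trm_compose[OF assms(1)]) (rule trm_var)
  then show "dfb C D (\<lambda>\<rho>. \<forall>a\<in>D. a \<epsilon> t \<rho> \<longrightarrow> Q \<rho> a)"
    by (intro dfb_ball dfb_imp dfb_mem trm_var assms)
  fix \<rho> :: "nat \<Rightarrow> 'a" assume "range \<rho> \<subseteq> D" "C \<subseteq> D" "trans_class D"
  then have "a \<in> D" if "a \<epsilon> t \<rho>" for a
    using trm_in[OF assms(1)] that unfolding trans_class_def ext_def by blast
  then show "(\<forall>a\<in>D. a \<epsilon> t \<rho> \<longrightarrow> Q \<rho> a) \<longleftrightarrow> (\<forall>a. a \<epsilon> t \<rho> \<longrightarrow> Q \<rho> a)"
    by blast
qed

lemma dfb_ex_in:
  assumes "trm C t" "dfb C D (\<lambda>\<rho>. Q (\<lambda>n. \<rho> (Suc n)) (\<rho> 0))"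
  shows "dfb C D (\<lambda>\<rho>. \<exists>a. a \<epsilon> t \<rho> \<and> Q \<rho> a)"
  using dfb_not[OF dfb_all_in[OF assms(1), of D "\<lambda>\<rho> a. \<not> Q \<rho> a"], OF dfb_not, OF assms(2)] by simp

lemmas dfb_basic = trm_var trm_const dfb_mem dfb_eq dfb_not dfb_conj dfb_disj dfb_iff
  dfb_all_in dfb_ex_in dfb_imp dfb_ball dfb_bex

section \<open>Bounded set-theoretic notions\<close>

lemma dfb_is_empty: "trm C t \<Longrightarrow> dfb C D (\<lambda>\<rho>. is_empty (t \<rho>))"
proof (rule dfb_subst1[where P = is_empty])
  have *: "is_empty x \<longleftrightarrow> (\<forall>y. y \<epsilon> x \<longrightarrow> y \<noteq> y)" for x
    by (auto simp: is_empty_def ext_def)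
  show "dfb C D (\<lambda>\<rho>. is_empty (\<rho> 0))"
    unfolding * by (intro dfb_basic)
qed

lemma dfb_subset: "trm C t \<Longrightarrow> trm C u \<Longrightarrow> dfb C D (\<lambda>\<rho>. ext (t \<rho>) \<subseteq> ext (u \<rho>))"
proof (rule dfb_subst2[where P = "\<lambda>x y. ext x \<subseteq> ext y"])
  have *: "ext x \<subseteq> ext y \<longleftrightarrow> (\<forall>z. z \<epsilon> x \<longrightarrow> z \<epsilon> y)" for x y
    by (auto simp: ext_def)
  show "dfb C D (\<lambda>\<rho>. ext (\<rho> 0) \<subseteq> ext (\<rho> 1))"
    unfolding * by (intro dfb_basic)
qed

lemma dfb_is_succ: "trm C t \<Longrightarrow> trm C u \<Longrightarrow> dfb C D (\<lambda>\<rho>. is_succ (t \<rho>) (u \<rho>))"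
proof (rule dfb_subst2[where P = is_succ])
  have *: "is_succ y x \<longleftrightarrow> (x \<epsilon> y \<and> (\<forall>z. z \<epsilon> x \<longrightarrow> z \<epsilon> y) \<and> (\<forall>z. z \<epsilon> y \<longrightarrow> z = x \<or> z \<epsilon> x))" for x y
    by (auto simp: is_succ_def ext_def)
  show "dfb C D (\<lambda>\<rho>. is_succ (\<rho> 0) (\<rho> 1))"
    unfolding * by (intro dfb_basic)
qed

lemma dfb_transitive: "trm C t \<Longrightarrow> dfb C D (\<lambda>\<rho>. transitive (t \<rho>))"
  by (rule dfb_subst1[where P = transitive])
    (unfold transitive_def, intro dfb_basic dfb_subset)

lemma dfb_ordinal: "trm C t \<Longrightarrow> dfb C D (\<lambda>\<rho>. ordinal (t \<rho>))"
  by (rule dfb_subst1[where P = ordinal])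
    (unfold ordinal_def, intro dfb_basic dfb_transitive)

lemma dfb_limit: "trm C t \<Longrightarrow> dfb C D (\<lambda>\<rho>. limit (t \<rho>))"
proof (rule dfb_subst1[where P = limit])
  \<comment> \<open>A predecessor of \<open>x\<close> is an element of \<open>x\<close>, which
    bounds the quantifier.\<close>
  have *: "limit x \<longleftrightarrow> ordinal x \<and> \<not> is_empty x \<and> \<not> (\<exists>y. y \<epsilon> x \<and> is_succ x y)" for x
    by (auto simp: limit_def is_succ_def ext_def)
  show "dfb C D (\<lambda>\<rho>. limit (\<rho> 0))"
    unfolding * by (intro dfb_basic dfb_ordinal dfb_is_empty dfb_is_succ)
qed

lemma dfb_Omega: "trm C t \<Longrightarrow> dfb C D (\<lambda>\<rho>. t \<rho> \<in> Omega)"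
proof (rule dfb_subst1[where P = "\<lambda>x. x \<in> Omega"])
  have **: "(\<exists>k. is_succ m k) \<longleftrightarrow> (\<exists>k. k \<epsilon> m \<and> is_succ m k)" for m
    by (auto simp: is_succ_def ext_def)
  have *: "x \<in> Omega \<longleftrightarrow> ordinal x \<and> (is_empty x \<or> (\<exists>k. k \<epsilon> x \<and> is_succ x k)) \<and>
    (\<forall>m. m \<epsilon> x \<longrightarrow> is_empty m \<or> (\<exists>k. k \<epsilon> m \<and> is_succ m k))" for x
    unfolding Omega_def ** by auto
  show "dfb C D (\<lambda>\<rho>. \<rho> 0 \<in> Omega)"
    unfolding * by (intro dfb_basic dfb_ordinal dfb_is_empty dfb_is_succ)
qed

lemma dfb_is_opair: "trm C t \<Longrightarrow> trm C u \<Longrightarrow> trm C v \<Longrightarrow> dfb C D (\<lambda>\<rho>. is_opair (t \<rho>) (u \<rho>) (v \<rho>))"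
proof (rule dfb_subst3[where P = is_opair])
  \<comment> \<open>The two components of a Kuratowski pair are elements of it, so the existential
    quantifiers become bounded.\<close>
  have *: "is_opair p a b \<longleftrightarrow> (\<exists>u. u \<epsilon> p \<and> (\<exists>v. v \<epsilon> p \<and> (\<forall>w. w \<epsilon> p \<longrightarrow> w = u \<or> w = v) \<and>
    a \<epsilon> u \<and> (\<forall>w. w \<epsilon> u \<longrightarrow> w = a) \<and> a \<epsilon> v \<and> b \<epsilon> v \<and> (\<forall>w. w \<epsilon> v \<longrightarrow> w = a \<or> w = b)))" for p a b
  proof -
    have pr: "ext p = {u, v} \<longleftrightarrow> u \<epsilon> p \<and> v \<epsilon> p \<and> (\<forall>w. w \<epsilon> p \<longrightarrow> w = u \<or> w = v)" for p u v
      by (auto simp: ext_def)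
    have sg: "ext u = {a} \<longleftrightarrow> a \<epsilon> u \<and> (\<forall>w. w \<epsilon> u \<longrightarrow> w = a)" for u a
      by (auto simp: ext_def)
    show ?thesis
      unfolding is_opair_def pr sg by blast
  qed
  show "dfb C D (\<lambda>\<rho>. is_opair (\<rho> 0) (\<rho> 1) (\<rho> 2))"
    unfolding * by (intro dfb_basic)
qed

lemma dfb_rel: "trm C t \<Longrightarrow> trm C u \<Longrightarrow> trm C v \<Longrightarrow> dfb C D (\<lambda>\<rho>. rel (t \<rho>) (u \<rho>) (v \<rho>))"
  by (rule dfb_subst3[where P = rel])
    (unfold rel_def, intro dfb_basic dfb_is_opair)

text \<open>These rules hold for every \<open>D\<close>. A condition that does not mention
  \<open>D\<close> and is accepted by them for all \<open>D\<close> is therefore absolute between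
  transitive classes containing its parameters.\<close>

lemmas dfb_delta0 = dfb_basic dfb_is_empty dfb_subset dfb_is_succ dfb_transitive dfb_ordinal
  dfb_limit dfb_Omega dfb_is_opair dfb_rel

section \<open>Back to formulas; definability without parameters\<close>

lemma dfb_sat2:
  assumes "dfb C D (\<lambda>\<rho>. Q (\<rho> 0) (\<rho> 1))" "C \<subseteq> D" "trans_class D" "D \<noteq> {}"
  shows "\<exists>\<phi> \<sigma>. range \<sigma> \<subseteq> D \<and> (\<forall>a\<in>D. \<forall>b\<in>D. Q a b \<longleftrightarrow> sat D (\<sigma>(0 := a, 1 := b)) \<phi>)"
proof -
  from assms obtain \<phi> \<tau> where \<phi>: "\<forall>n. trm C (\<tau> n)"
    "\<forall>\<rho>. range \<rho> \<subseteq> D \<longrightarrow> (Q (\<rho> 0) (\<rho> 1) \<longleftrightarrow> sat D (\<lambda>n. \<tau> n \<rho>) \<phi>)"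
    unfolding dfb_def by blast
  obtain d where d: "d \<in> D" using assms by blast
  \<comment> \<open>Positions 0 and 1 are reserved for the two arguments, so everything else moves
    to \<open>n + 2\<close>, out of reach of the updates.\<close>
  define f where "f n = (if \<tau> n = (\<lambda>\<rho>. \<rho> 0) then 0 else if \<tau> n = (\<lambda>\<rho>. \<rho> 1) then 1 else n + 2)" for n
  obtain \<psi> where \<psi>: "\<forall>\<rho>. sat D \<rho> \<psi> \<longleftrightarrow> sat D (\<lambda>n. \<rho> (f n)) \<phi>"
    using sat_rename[of f \<phi> D] by blast
  \<comment> \<open>Parameters keep their value; variables other than the two arguments receive the
    default \<open>d\<close>, which cannot matter because \<open>Q\<close> does not depend on
    them.\<close>
  define \<sigma> where "\<sigma> n = \<tau> (n - 2) (\<lambda>_. d)" for n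
  show ?thesis
  proof (intro exI conjI ballI)
    show "range \<sigma> \<subseteq> D"
    proof
      fix x assume "x \<in> range \<sigma>"
      then obtain n where "x = \<tau> (n - 2) (\<lambda>_. d)" unfolding \<sigma>_def by blast
      then show "x \<in> D" using trm_in[of C "\<tau> (n - 2)" D "\<lambda>_. d"] \<phi>(1) d assms(2) by simp
    qed
    fix a b assume ab: "a \<in> D" "b \<in> D"
    let ?\<rho> = "(\<lambda>_::nat. d)(0 := a, 1 := b)"
    have "range ?\<rho> \<subseteq> D" using ab d by auto
    from \<phi>(2)[THEN spec, THEN mp, OF this]
    have "Q (?\<rho> 0) (?\<rho> 1) \<longleftrightarrow> sat D (\<lambda>n. \<tau> n ?\<rho>) \<phi>" .
    moreover have "?\<rho> 0 = a" "?\<rho> 1 = b" by simp_all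
    ultimately have "Q a b \<longleftrightarrow> sat D (\<lambda>n. \<tau> n ?\<rho>) \<phi>" by (simp only:)
    also have "(\<lambda>n. \<tau> n ?\<rho>) = (\<lambda>n. (\<sigma>(0 := a, 1 := b)) (f n))"
    proof
      fix n
      from \<phi>(1) have "trm C (\<tau> n)" ..
      then have *: "\<tau> n ?\<rho> = \<tau> n (\<lambda>_. d)" if "\<tau> n \<noteq> (\<lambda>\<rho>. \<rho> 0)" "\<tau> n \<noteq> (\<lambda>\<rho>. \<rho> 1)"
        using that unfolding trm_def by (metis One_nat_def fun_upd_other)
      consider "\<tau> n = (\<lambda>\<rho>. \<rho> 0)" | "\<tau> n \<noteq> (\<lambda>\<rho>. \<rho> 0)" "\<tau> n = (\<lambda>\<rho>. \<rho> 1)"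
        | "\<tau> n \<noteq> (\<lambda>\<rho>. \<rho> 0)" "\<tau> n \<noteq> (\<lambda>\<rho>. \<rho> 1)"
        by blast
      then show "\<tau> n ?\<rho> = (\<sigma>(0 := a, 1 := b)) (f n)"
      proof cases
        case 3
        then have "f n = Suc (Suc n)" by (simp add: f_def)
        then show ?thesis using * 3 by (simp add: \<sigma>_def)
      next
        case 2
        then have "f n = 1" by (simp add: f_def)
        then show ?thesis using 2(2) by simp
      next
        case 1
        then have "f n = 0" by (simp add: f_def)
        then show ?thesis using 1 by simp
      qed
    qed
    finally show "Q a b \<longleftrightarrow> sat D (\<sigma>(0 := a, 1 := b)) \<psi>" using \<psi> by blast
  qed
qed

lemma dfb_sat1:
  assumes "dfb C D (\<lambda>\<rho>. Q (\<rho> 0))" "C \<subseteq> D" "trans_class D" "D \<noteq> {}"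
  shows "\<exists>\<phi> \<sigma>. range \<sigma> \<subseteq> D \<and> (\<forall>a\<in>D. Q a \<longleftrightarrow> sat D (\<sigma>(0 := a)) \<phi>)"
proof -
  obtain \<phi> \<sigma> where \<phi>: "range \<sigma> \<subseteq> D"
    "\<forall>a\<in>D. \<forall>b\<in>D. Q a \<longleftrightarrow> sat D (\<sigma>(0 := a, 1 := b)) \<phi>"
    using dfb_sat2[of C D "\<lambda>a b. Q a", OF assms] by blast
  have "\<sigma> 1 \<in> D" using \<phi>(1) by blast
  moreover have "\<sigma>(0 := a, 1 := \<sigma> 1) = \<sigma>(0 := a)" for a
    by (rule HOL.ext) simp
  ultimately have "\<forall>a\<in>D. Q a \<longleftrightarrow> sat D (\<sigma>(0 := a)) \<phi>"
    using \<phi>(2) by metis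
  with \<phi>(1) show ?thesis by blast
qed

text \<open>With no constants every term is a variable, and under a constant assignment all
  variables have the same value. They can thus all be renamed to 0, as \<open>definable_in\<close>
  requires.\<close>

lemma definable_in0:
  assumes "dfb {} D (\<lambda>\<rho>. Q (\<rho> 0))" "trans_class D" "x \<in> D" "\<And>v. v \<in> D \<Longrightarrow> Q v \<longleftrightarrow> v = x"
  shows "definable_in D x"
proof -
  from assms obtain \<phi> \<tau> where \<phi>: "\<forall>n. trm {} (\<tau> n)"
    "\<forall>\<rho>. range \<rho> \<subseteq> D \<longrightarrow> (Q (\<rho> 0) \<longleftrightarrow> sat D (\<lambda>n. \<tau> n \<rho>) \<phi>)"
    unfolding dfb_def by blast
  obtain \<psi> where \<psi>: "fv \<psi> \<subseteq> (\<lambda>_. 0) ` fv \<phi>" "\<forall>\<rho>. sat D \<rho> \<psi> \<longleftrightarrow> sat D (\<lambda>n. \<rho> 0) \<phi>"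
    using sat_rename[of "\<lambda>_. 0" \<phi> D] by blast
  have \<tau>: "\<tau> n (\<lambda>_. v) = v" for n v using \<phi>(1)[rule_format, of n] unfolding trm_def by auto
  have "Q v \<longleftrightarrow> sat D (\<lambda>_. v) \<psi>" if "v \<in> D" for v
    using \<phi>(2)[rule_format, of "\<lambda>_. v"] \<psi>(2) that by (simp add: \<tau>)
  then have "\<And>v. v \<in> D \<Longrightarrow> sat D (\<lambda>_. v) \<psi> \<longleftrightarrow> v = x" using assms(4) by blast
  then show ?thesis unfolding definable_in_def
    using \<psi>(1) assms(3) by (intro conjI exI[of _ \<psi>]) auto
qed

text \<open>The parameter is eliminated by quantifying over the elements that satisfy its defining
  formula; \<open>c\<close> is the only one.\<close>

lemma dfb_definable_param:
  assumes c: "definable_in D c" and Q: "dfb {} D (\<lambda>\<rho>. Q (\<lambda>n. \<rho> (Suc n)) (\<rho> 0))"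
  shows "dfb {} D (\<lambda>\<rho>. Q \<rho> c)"
proof -
  from c obtain \<phi> where \<phi>: "\<And>v. v \<in> D \<Longrightarrow> sat D (\<lambda>_. v) \<phi> \<longleftrightarrow> v = c" and "c \<in> D"
    unfolding definable_in_def by blast
  have "dfb {} D (\<lambda>\<rho>. sat D (\<lambda>_. \<rho> 0) \<phi>)"
    unfolding dfb_def by (intro impI exI[of _ \<phi>] exI[of _ "\<lambda>n \<rho>. \<rho> 0"]) (auto intro: trm_var)
  with Q have "dfb {} D (\<lambda>\<rho>. \<exists>a\<in>D. sat D (\<lambda>_. a) \<phi> \<and> Q \<rho> a)"
    by (intro dfb_bex dfb_conj)
  then show ?thesis
    by (rule dfb_cong) (use \<phi> \<open>c \<in> D\<close> in auto)
qed

lemma definable_in2: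
  assumes "definable_in D c" "definable_in D d" "trans_class D"
    "dfb {} D (\<lambda>\<rho>. Q (\<rho> 0) (\<rho> 1) (\<rho> 2))" "x \<in> D" "\<And>v. v \<in> D \<Longrightarrow> Q c d v \<longleftrightarrow> v = x"
  shows "definable_in D x"
proof (rule definable_in0[where Q = "Q c d"])
  have "dfb {} D (\<lambda>\<rho>. Q (\<rho> 0) (\<rho> (Suc 0)) (\<rho> (Suc (Suc 0))))"
    using assms(4) unfolding One_nat_def numeral_2_eq_2 .
  \<comment> \<open>Parameters are eliminated at position 0, so the places of \<open>c\<close> and
    \<open>d\<close> are exchanged to remove \<open>d\<close> first.\<close>
  from dfb_subst3[OF this[folded One_nat_def numeral_2_eq_2] trm_var[of _ 1] trm_var[of _ 0] trm_var[of _ 2]]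
  have "dfb {} D (\<lambda>\<rho>. Q (\<rho> (Suc 0)) (\<rho> 0) (\<rho> (Suc (Suc 0))))"
    unfolding One_nat_def numeral_2_eq_2 .
  from dfb_definable_param[OF assms(2), where Q = "\<lambda>\<rho> a. Q (\<rho> 0) a (\<rho> (Suc 0))", OF this]
  have "dfb {} D (\<lambda>\<rho>. Q (\<rho> 0) d (\<rho> (Suc 0)))" .
  from dfb_definable_param[OF assms(1), where Q = "\<lambda>\<rho> a. Q a d (\<rho> 0)", OF this]
  show "dfb {} D (\<lambda>\<rho>. Q c d (\<rho> 0))" .
qed (use assms in auto)

end


subsection \<open>Sets of a model of ZFC\<close>

locale zfc_model = membership mem for mem :: "'a \<Rightarrow> 'a \<Rightarrow> bool"  (infix "\<epsilon>" 50) +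
  assumes ZFC: ZFC
begin

abbreviation dfv :: "((nat \<Rightarrow> 'a) \<Rightarrow> bool) \<Rightarrow> bool" where
  "dfv \<equiv> dfb UNIV UNIV"

lemmas dfv_intros = dfb_delta0 dfb_all dfb_ex UNIV_I

lemma trans_class_UNIV: "trans_class UNIV"
  by (simp add: trans_class_def)

lemma in_ext [simp]: "z \<in> ext x \<longleftrightarrow> z \<epsilon> x"
  by (simp add: ext_def)

lemma Ball_ext [simp]: "(\<forall>z\<in>ext x. P z) \<longleftrightarrow> (\<forall>z. z \<epsilon> x \<longrightarrow> P z)"
  by (simp add: Ball_def)

lemma Bex_ext [simp]: "(\<exists>z\<in>ext x. P z) \<longleftrightarrow> (\<exists>z. z \<epsilon> x \<and> P z)"
  by (simp add: Bex_def)

lemma ext_inject [simp]: "ext x = ext y \<longleftrightarrow> x = y"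
  using ZFC unfolding ZFC_def extensionality_def by blast

definition is_set :: "'a set \<Rightarrow> bool" where
  "is_set S \<longleftrightarrow> (\<exists>x. ext x = S)"

definition mk :: "'a set \<Rightarrow> 'a" where
  "mk S = (THE x. ext x = S)"

lemma mk_ext [simp]: "mk (ext x) = x"
  by (simp add: mk_def)

lemma is_set_ext [simp]: "is_set (ext x)"
  by (auto simp: is_set_def)

lemma ext_mk [simp]: "is_set S \<Longrightarrow> ext (mk S) = S"
  by (auto simp: is_set_def)

lemma mem_mk [simp]: "is_set S \<Longrightarrow> z \<epsilon> mk S \<longleftrightarrow> z \<in> S"
  by (metis ext_mk in_ext)

lemma is_set_sep:
  assumes "dfv (\<lambda>\<rho>. Q (\<rho> 0))" "\<And>z. Q z \<Longrightarrow> z \<epsilon> x"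
  shows "is_set {z. Q z}"
proof -
  obtain \<phi> \<sigma> where \<phi>: "\<forall>a\<in>UNIV. Q a \<longleftrightarrow> sat UNIV (\<sigma>(0 := a)) \<phi>"
    using dfb_sat1[OF assms(1) _ trans_class_UNIV] by blast
  from ZFC obtain y where "ext y = {z. z \<epsilon> x \<and> sat UNIV (\<sigma>(0 := z)) \<phi>}"
    unfolding ZFC_def separation_def by blast
  then have "ext y = {z. Q z}" using \<phi> assms(2) by blast
  then show ?thesis unfolding is_set_def by blast
qed

text \<open>The relation has to be functional only on \<open>x\<close>; this is how recursion and
  the choice of least levels produce sets.\<close>

lemma is_set_replace:
  assumes "dfv (\<lambda>\<rho>. Q (\<rho> 0) (\<rho> 1))" "\<And>u. u \<epsilon> x \<Longrightarrow> \<exists>!v. Q u v"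
  shows "is_set {v. \<exists>u. u \<epsilon> x \<and> Q u v}"
proof -
  obtain \<phi> \<sigma> where "\<forall>a\<in>UNIV. \<forall>b\<in>UNIV. Q a b \<longleftrightarrow> sat UNIV (\<sigma>(0 := a, 1 := b)) \<phi>"
    using dfb_sat2[OF assms(1) subset_refl trans_class_UNIV UNIV_not_empty] by (elim exE conjE) (rule that)
  then have \<phi>: "sat UNIV (\<sigma>(0 := a, 1 := b)) \<phi> \<longleftrightarrow> Q a b" for a b by blast
  have "(\<forall>u. u \<epsilon> x \<longrightarrow> (\<exists>!v. sat UNIV (\<sigma>(0 := u, 1 := v)) \<phi>)) \<longrightarrow>
      (\<exists>y. ext y = {v. \<exists>u. u \<epsilon> x \<and> sat UNIV (\<sigma>(0 := u, 1 := v)) \<phi>})"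
    using ZFC unfolding ZFC_def replacement_def by blast
  then show ?thesis using assms(2) unfolding \<phi> is_set_def by blast
qed

lemma is_set_pair [simp]: "is_set {a, b}"
  using ZFC unfolding ZFC_def pairing_def is_set_def by blast

lemma is_set_single [simp]: "is_set {a}"
  using is_set_pair[of a a] by simp

lemma is_set_empty [simp]: "is_set {}"
proof -
  have "dfv (\<lambda>\<rho>. \<rho> 0 \<noteq> \<rho> 0)" by (intro dfv_intros)
  from is_set_sep[of "\<lambda>x. x \<noteq> x", OF this] show ?thesis by simp
qed

lemma is_set_Union [simp]: "is_set (\<Union>y\<in>ext x. ext y)"
proof -
  have "(\<Union>y\<in>ext x. ext y) = {z. \<exists>y. y \<epsilon> x \<and> z \<epsilon> y}" by auto
  then show ?thesis using ZFC unfolding ZFC_def union_def is_set_def by metis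
qed

lemma is_set_Un [simp]: "is_set S \<Longrightarrow> is_set T \<Longrightarrow> is_set (S \<union> T)"
  using is_set_Union[of "mk {mk S, mk T}"] by simp

lemma is_set_insert [simp]: "is_set S \<Longrightarrow> is_set (insert a S)"
  using is_set_Un[of "{a}" S] by simp

lemma is_set_Pow [simp]: "is_set {z. ext z \<subseteq> ext x}"
  using ZFC unfolding ZFC_def powerset_def is_set_def by blast

lemma is_set_finite: "finite S \<Longrightarrow> is_set S"
  by (induction rule: finite_induct) simp_all

section \<open>Empty set, successors, pairs, graphs and foundation\<close>

definition emp :: 'a where "emp = mk {}"
definition suc :: "'a \<Rightarrow> 'a" where "suc x = mk (insert x (ext x))"
definition opr :: "'a \<Rightarrow> 'a \<Rightarrow> 'a" where "opr a b = mk {mk {a}, mk {a, b}}"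

lemma mem_emp [simp]: "\<not> x \<epsilon> emp"
  by (simp add: emp_def)

lemma ext_emp [simp]: "ext emp = {}"
  by (simp add: emp_def)

lemma is_empty_iff [simp]: "is_empty x \<longleftrightarrow> x = emp"
  unfolding is_empty_def using ext_inject[of x emp] by simp

lemma ext_suc [simp]: "ext (suc x) = insert x (ext x)"
  by (simp add: suc_def)

lemma mem_suc [simp]: "z \<epsilon> suc x \<longleftrightarrow> z = x \<or> z \<epsilon> x"
  by (simp add: suc_def)

lemma is_succ_iff [simp]: "is_succ y x \<longleftrightarrow> y = suc x"
  unfolding is_succ_def using ext_inject[of y "suc x"] by simp

lemma mk_inject [simp]: "is_set S \<Longrightarrow> is_set T \<Longrightarrow> mk S = mk T \<longleftrightarrow> S = T"
  by (metis ext_mk)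

lemma is_opair_iff [simp]: "is_opair p a b \<longleftrightarrow> p = opr a b"
proof
  assume "is_opair p a b"
  then obtain u v where *: "ext p = {u, v}" "ext u = {a}" "ext v = {a, b}"
    unfolding is_opair_def by blast
  have "u = mk {a}" "v = mk {a, b}" "p = mk {u, v}"
    using mk_ext[of u] mk_ext[of v] mk_ext[of p] * by simp_all
  then show "p = opr a b" by (simp add: opr_def)
next
  assume "p = opr a b"
  then show "is_opair p a b" unfolding is_opair_def opr_def
    by (intro exI[of _ "mk {a}"] exI[of _ "mk {a, b}"]) simp
qed

lemma opr_inject [simp]: "opr a b = opr c d \<longleftrightarrow> a = c \<and> b = d"
  unfolding opr_def by (auto simp: doubleton_eq_iff)

lemma rel_iff: "rel f a b \<longleftrightarrow> opr a b \<epsilon> f"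
  by (simp add: rel_def)

text \<open>Kuratowski pairs over \<open>x\<close> and \<open>y\<close> lie in the double power set
  of their union. Only a bound is produced; separation does the rest wherever a set of pairs is
  wanted.\<close>

lemma pair_bound: "\<exists>q. \<forall>a b. a \<epsilon> x \<longrightarrow> b \<epsilon> y \<longrightarrow> opr a b \<epsilon> q"
proof -
  define u where "u = mk (ext x \<union> ext y)"
  have "is_set (ext x \<union> ext y)" by simp
  then have u: "ext u = ext x \<union> ext y" by (simp only: u_def ext_mk)
  define v where "v = mk {z. ext z \<subseteq> ext u}"
  have v: "ext v = {z. ext z \<subseteq> ext u}" by (simp add: v_def)
  define q where "q = mk {z. ext z \<subseteq> ext v}"
  have q: "ext q = {z. ext z \<subseteq> ext v}" by (simp add: q_def)
  have "opr a b \<in> ext q" if "a \<epsilon> x" "b \<epsilon> y" for a b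
  proof -
    have "mk {a} \<in> ext v" "mk {a, b} \<in> ext v" using that unfolding v by (simp_all add: u)
    then show ?thesis unfolding q opr_def by simp
  qed
  then show ?thesis by (intro exI[of _ q]) simp
qed

lemma ex_graph:
  assumes "dfv (\<lambda>\<rho>. Q (\<rho> 0) (\<rho> 1))" "\<And>a b. Q a b \<Longrightarrow> a \<epsilon> x \<and> b \<epsilon> y"
  shows "\<exists>f. (\<forall>a b. rel f a b \<longleftrightarrow> Q a b) \<and> (\<forall>p. p \<epsilon> f \<longrightarrow> (\<exists>a b. Q a b \<and> p = opr a b))"
proof -
  obtain q where q: "\<And>a b. a \<epsilon> x \<Longrightarrow> b \<epsilon> y \<Longrightarrow> opr a b \<epsilon> q" using pair_bound by blast
  have s: "is_set {p. \<exists>a b. Q a b \<and> is_opair p a b}"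
  proof (rule is_set_sep)
    show "dfv (\<lambda>\<rho>. \<exists>a b. Q a b \<and> is_opair (\<rho> 0) a b)"
      by (intro dfb_ex dfb_conj dfb_subst2[OF assms(1)] dfv_intros)
  qed (use q assms(2) in auto)
  show ?thesis
    by (rule exI[of _ "mk {p. \<exists>a b. Q a b \<and> is_opair p a b}"]) (use s in \<open>simp add: rel_iff\<close>)
qed

lemma foundation_minimal:
  assumes "ext x \<noteq> {}"
  obtains y where "y \<epsilon> x" "\<And>z. z \<epsilon> y \<Longrightarrow> \<not> z \<epsilon> x"
proof -
  from ZFC assms obtain y where "y \<epsilon> x" "ext y \<inter> ext x = {}"
    unfolding ZFC_def foundation_def by blast
  then show ?thesis using that in_ext by blast
qed

lemma mem_irrefl [simp]: "\<not> x \<epsilon> x"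
proof
  assume "x \<epsilon> x"
  have "ext (mk {x}) \<noteq> {}" by simp
  then show False by (rule foundation_minimal) (use \<open>x \<epsilon> x\<close> in auto)
qed

lemma mem_asym:
  assumes "x \<epsilon> y"
  shows "\<not> y \<epsilon> x"
proof
  assume "y \<epsilon> x"
  have "ext (mk {x, y}) \<noteq> {}" by simp
  then show False by (rule foundation_minimal) (use assms \<open>y \<epsilon> x\<close> in auto)
qed

lemma suc_inject [simp]: "suc a = suc b \<longleftrightarrow> a = b"
  by (metis mem_asym mem_suc)

lemma suc_neq_emp [simp]: "suc a \<noteq> emp" "emp \<noteq> suc a"
  by (metis mem_emp mem_suc)+


subsection \<open>Ordinals and natural numbers\<close>

lemma transitive_iff: "transitive x \<longleftrightarrow> (\<forall>y z. y \<epsilon> x \<longrightarrow> z \<epsilon> y \<longrightarrow> z \<epsilon> x)"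
  unfolding transitive_def ext_def by blast

lemma ordinal_mem: "ordinal a \<Longrightarrow> b \<epsilon> a \<Longrightarrow> ordinal b"
  unfolding ordinal_def transitive_iff by blast

lemma ordinal_trans: "ordinal a \<Longrightarrow> b \<epsilon> a \<Longrightarrow> c \<epsilon> b \<Longrightarrow> c \<epsilon> a"
  unfolding ordinal_def transitive_iff by blast

lemma ordinalI: "(\<And>b c. b \<epsilon> a \<Longrightarrow> c \<epsilon> b \<Longrightarrow> c \<epsilon> a) \<Longrightarrow> (\<And>b. b \<epsilon> a \<Longrightarrow> ordinal b) \<Longrightarrow> ordinal a"
  unfolding ordinal_def transitive_iff by blast

lemma ordinal_suc: "ordinal a \<Longrightarrow> ordinal (suc a)"
  by (rule ordinalI) (auto intro: ordinal_trans ordinal_mem)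

lemma ordinal_emp [simp]: "ordinal emp"
  by (rule ordinalI) simp_all

text \<open>The ordinals of the model need not be well-founded from outside, so only conditions
  given by formulas admit induction: their counterexamples form a set, to which foundation
  applies.\<close>

lemma ordinal_induct:
  assumes Q: "dfv (\<lambda>\<rho>. Q (\<rho> 0))"
    and step: "\<And>a. ordinal a \<Longrightarrow> (\<And>b. b \<epsilon> a \<Longrightarrow> Q b) \<Longrightarrow> Q a"
    and "ordinal a"
  shows "Q a"
proof (rule ccontr)
  assume "\<not> Q a"
  \<comment> \<open>Bounding by \<open>suc a\<close> instead of \<open>a\<close> keeps the given
    counterexample itself in the set.\<close>
  let ?S = "{b. b \<epsilon> suc a \<and> \<not> Q b}"
  have "dfv (\<lambda>\<rho>. \<rho> 0 \<epsilon> suc a \<and> \<not> Q (\<rho> 0))" by (intro dfv_intros Q)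
  then have S: "is_set ?S" by (rule is_set_sep[where Q = "\<lambda>b. b \<epsilon> suc a \<and> \<not> Q b"]) blast
  with \<open>\<not> Q a\<close> have "ext (mk ?S) \<noteq> {}" by auto
  then obtain b where b: "b \<epsilon> mk ?S" "\<And>c. c \<epsilon> b \<Longrightarrow> \<not> c \<epsilon> mk ?S"
    by (rule foundation_minimal) blast
  have o: "ordinal (suc a)" by (rule ordinal_suc) fact
  have "b \<epsilon> suc a" "\<not> Q b" using b(1) S by simp_all
  moreover have "Q c" if "c \<epsilon> b" for c
    using b(2)[OF that] S ordinal_trans[OF o \<open>b \<epsilon> suc a\<close> that] by simp
  ultimately show False using step ordinal_mem[OF o] by blast
qed

text \<open>Two nested inductions: if all smaller pairs are comparable but \<open>a\<close> and
  \<open>b\<close> are not, each element of either one belongs to the other, and extensionality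
  makes them equal.\<close>

lemma ordinal_linear:
  assumes "ordinal a" "ordinal b"
  shows "a \<epsilon> b \<or> a = b \<or> b \<epsilon> a"
proof -
  have "\<forall>b. ordinal b \<longrightarrow> a \<epsilon> b \<or> a = b \<or> b \<epsilon> a"
  proof (rule ordinal_induct[OF _ _ assms(1)])
    show "dfv (\<lambda>\<rho>. \<forall>b. ordinal b \<longrightarrow> \<rho> 0 \<epsilon> b \<or> \<rho> 0 = b \<or> b \<epsilon> \<rho> 0)" by (intro dfv_intros)
  next
    fix a assume a: "ordinal a" and IH: "\<And>a'. a' \<epsilon> a \<Longrightarrow> \<forall>b. ordinal b \<longrightarrow> a' \<epsilon> b \<or> a' = b \<or> b \<epsilon> a'"
    show "\<forall>b. ordinal b \<longrightarrow> a \<epsilon> b \<or> a = b \<or> b \<epsilon> a"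
    proof (intro allI impI)
      fix b assume "ordinal b"
      then show "a \<epsilon> b \<or> a = b \<or> b \<epsilon> a"
      proof (rule ordinal_induct[rotated 2])
        show "dfv (\<lambda>\<rho>. a \<epsilon> \<rho> 0 \<or> a = \<rho> 0 \<or> \<rho> 0 \<epsilon> a)" by (intro dfv_intros)
      next
        fix b assume b: "ordinal b" and IH': "\<And>b'. b' \<epsilon> b \<Longrightarrow> a \<epsilon> b' \<or> a = b' \<or> b' \<epsilon> a"
        show "a \<epsilon> b \<or> a = b \<or> b \<epsilon> a"
        proof (rule ccontr)
          assume *: "\<not> ?thesis"
          have "ext a = ext b"
          proof (intro equalityI subsetI; unfold in_ext)
            fix z assume "z \<epsilon> a"
            with IH b have "z \<epsilon> b \<or> z = b \<or> b \<epsilon> z" by blast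
            then show "z \<epsilon> b" using * \<open>z \<epsilon> a\<close> ordinal_trans[OF a] by blast
          next
            fix z assume "z \<epsilon> b"
            with IH' have "a \<epsilon> z \<or> a = z \<or> z \<epsilon> a" by blast
            then show "z \<epsilon> a" using * \<open>z \<epsilon> b\<close> ordinal_trans[OF b] by blast
          qed
          with * show False by simp
        qed
      qed
    qed
  qed
  with assms(2) show ?thesis by blast
qed

text \<open>Uniqueness comes from linearity; in this form the least ordinal can be fed to
  replacement and used as a canonical choice.\<close>

lemma ordinal_least:
  assumes "dfv (\<lambda>\<rho>. Q (\<rho> 0))" "ordinal a" "Q a"
  shows "\<exists>!m. ordinal m \<and> Q m \<and> (\<forall>k. k \<epsilon> m \<longrightarrow> \<not> Q k)"
proof -
  have "\<exists>m. ordinal m \<and> Q m \<and> (\<forall>k. k \<epsilon> m \<longrightarrow> \<not> Q k)"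
  proof (rule ccontr)
    assume *: "\<not> ?thesis"
    have "\<not> Q a"
    proof (rule ordinal_induct[OF _ _ assms(2)])
      show "dfv (\<lambda>\<rho>. \<not> Q (\<rho> 0))" by (intro dfb_not assms(1))
    qed (use * in blast)
    with assms(3) show False by blast
  qed
  moreover have "m = m'" if "ordinal m \<and> Q m \<and> (\<forall>k. k \<epsilon> m \<longrightarrow> \<not> Q k)"
    "ordinal m' \<and> Q m' \<and> (\<forall>k. k \<epsilon> m' \<longrightarrow> \<not> Q k)" for m m'
    using that ordinal_linear[of m m'] by blast
  ultimately show ?thesis by blast
qed

section \<open>Natural numbers of the model\<close>

lemma Omega_iff: "n \<in> Omega \<longleftrightarrow> ordinal n \<and> (\<forall>m. m = n \<or> m \<epsilon> n \<longrightarrow> m = emp \<or> (\<exists>k. m = suc k))"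
  by (simp add: Omega_def)

lemma Omega_ordinal: "n \<in> Omega \<Longrightarrow> ordinal n"
  by (simp add: Omega_def)

lemma Omega_mem: "n \<in> Omega \<Longrightarrow> m \<epsilon> n \<Longrightarrow> m \<in> Omega"
  unfolding Omega_iff using ordinal_mem ordinal_trans by metis

lemma Omega_emp [simp]: "emp \<in> Omega"
  by (simp add: Omega_iff)

lemma Omega_suc [simp]: "n \<in> Omega \<Longrightarrow> suc n \<in> Omega"
  by (auto simp: Omega_iff ordinal_suc)

lemma Omega_induct:
  assumes Q: "dfv (\<lambda>\<rho>. Q (\<rho> 0))"
    and "Q emp" "\<And>n. n \<in> Omega \<Longrightarrow> Q n \<Longrightarrow> Q (suc n)" "n \<in> Omega"
  shows "Q n"
proof -
  have "n \<in> Omega \<longrightarrow> Q n"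
  proof (rule ordinal_induct[OF _ _ Omega_ordinal[OF assms(4)]])
    show "dfv (\<lambda>\<rho>. \<rho> 0 \<in> Omega \<longrightarrow> Q (\<rho> 0))" by (intro dfv_intros Q)
  next
    fix a assume IH: "\<And>b. b \<epsilon> a \<Longrightarrow> b \<in> Omega \<longrightarrow> Q b"
    show "a \<in> Omega \<longrightarrow> Q a"
    proof
      assume a: "a \<in> Omega"
      then consider "a = emp" | k where "a = suc k" by (auto simp: Omega_iff)
      then show "Q a"
      proof cases
        case 2
        then have "k \<epsilon> a" by simp
        then show ?thesis using IH Omega_mem[OF a] assms(3) 2 by blast
      qed (simp add: assms(2))
    qed
  qed
  with assms(4) show ?thesis by blast
qed

text \<open>The axiom of infinity gives some inductive set; internal induction puts the whole class
  \<open>Omega\<close> inside it, so separation applies.\<close>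

lemma is_set_Omega [simp]: "is_set Omega"
proof -
  obtain w where w: "emp \<epsilon> w" "\<And>x. x \<epsilon> w \<Longrightarrow> suc x \<epsilon> w"
    using ZFC unfolding ZFC_def infinity_def by auto
  have "n \<epsilon> w" if "n \<in> Omega" for n
  proof (rule Omega_induct[OF _ _ _ that])
    show "dfv (\<lambda>\<rho>. \<rho> 0 \<epsilon> w)" by (intro dfv_intros)
  qed (use w in auto)
  moreover have "dfv (\<lambda>\<rho>. \<rho> 0 \<in> Omega)" by (intro dfv_intros)
  ultimately show ?thesis using is_set_sep[of "\<lambda>n. n \<in> Omega" w] by simp
qed

definition omega :: 'a where "omega = mk Omega"

lemma mem_omega [simp]: "n \<epsilon> omega \<longleftrightarrow> n \<in> Omega"
  by (simp add: omega_def)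

lemma ext_omega [simp]: "ext omega = Omega"
  by (simp add: omega_def)

lemma ordinal_cases:
  assumes "ordinal a"
  obtains "a = emp" | b where "a = suc b" "b \<epsilon> a" "ordinal b" | "limit a"
  using assms ordinal_mem[OF assms] unfolding limit_def by auto

lemma limit_simps [simp]: "\<not> limit emp" "\<not> limit (suc b)"
  by (auto simp: limit_def)

lemma is_function_iff: "is_function f X Y \<longleftrightarrow> (\<forall>p. p \<epsilon> f \<longrightarrow> (\<exists>a\<in>X. \<exists>b\<in>Y. p = opr a b)) \<and> (\<forall>a\<in>X. \<exists>!b. rel f a b)"
  by (simp add: is_function_def)


subsection \<open>Transfinite recursion\<close>

text \<open>The domain is the successor of \<alpha>, so the value at \<alpha> is included and
  \<open>is_hierarchy\<close> becomes an instance.\<close>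

definition attempt :: "('a \<Rightarrow> 'a \<Rightarrow> 'a \<Rightarrow> bool) \<Rightarrow> 'a \<Rightarrow> 'a \<Rightarrow> bool" where
  "attempt \<Phi> \<alpha> f \<longleftrightarrow> ordinal \<alpha> \<and> is_function f (insert \<alpha> (ext \<alpha>)) UNIV \<and>
     (\<forall>\<beta> v. rel f \<beta> v \<longrightarrow> \<Phi> f \<beta> v)"

definition rec :: "('a \<Rightarrow> 'a \<Rightarrow> 'a \<Rightarrow> bool) \<Rightarrow> 'a \<Rightarrow> 'a \<Rightarrow> bool" where
  "rec \<Phi> \<beta> v \<longleftrightarrow> (\<exists>f. attempt \<Phi> \<beta> f \<and> rel f \<beta> v)"

text \<open>The last clause makes the step depend only on values below \<beta>. It allows passing a
  whole attempt, defined also at and above \<beta>, in place of its restriction.\<close>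

definition step_relation :: "('a \<Rightarrow> 'a \<Rightarrow> 'a \<Rightarrow> bool) \<Rightarrow> bool" where
  "step_relation \<Phi> \<longleftrightarrow> dfv (\<lambda>\<rho>. \<Phi> (\<rho> 0) (\<rho> 1) (\<rho> 2)) \<and>
     (\<forall>f \<beta>. ordinal \<beta> \<longrightarrow> (\<forall>\<gamma>. \<gamma> \<epsilon> \<beta> \<longrightarrow> (\<exists>!u. rel f \<gamma> u)) \<longrightarrow> (\<exists>!v. \<Phi> f \<beta> v)) \<and>
     (\<forall>f g \<beta> v. (\<forall>\<gamma> u. \<gamma> \<epsilon> \<beta> \<longrightarrow> (rel f \<gamma> u \<longleftrightarrow> rel g \<gamma> u)) \<longrightarrow> \<Phi> f \<beta> v \<longrightarrow> \<Phi> g \<beta> v)"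

context
  fixes \<Phi> :: "'a \<Rightarrow> 'a \<Rightarrow> 'a \<Rightarrow> bool"
  assumes \<Phi>: "step_relation \<Phi>"
begin

lemma step_dfv: "dfv (\<lambda>\<rho>. \<Phi> (\<rho> 0) (\<rho> 1) (\<rho> 2))"
  using \<Phi> by (simp add: step_relation_def)

lemma step_ex1: "ordinal \<beta> \<Longrightarrow> (\<And>\<gamma>. \<gamma> \<epsilon> \<beta> \<Longrightarrow> \<exists>!u. rel f \<gamma> u) \<Longrightarrow> \<exists>!v. \<Phi> f \<beta> v"
  using \<Phi> by (simp add: step_relation_def)

lemma step_local: "(\<And>\<gamma> u. \<gamma> \<epsilon> \<beta> \<Longrightarrow> rel f \<gamma> u \<longleftrightarrow> rel g \<gamma> u) \<Longrightarrow> \<Phi> f \<beta> v \<Longrightarrow> \<Phi> g \<beta> v"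
  using \<Phi> unfolding step_relation_def by blast

lemma dfb_attempt: "trm UNIV t \<Longrightarrow> trm UNIV u \<Longrightarrow> dfv (\<lambda>\<rho>. attempt \<Phi> (t \<rho>) (u \<rho>))"
proof (rule dfb_subst2[where P = "attempt \<Phi>"])
  have *: "attempt \<Phi> \<alpha> f \<longleftrightarrow> ordinal \<alpha> \<and> (\<forall>p. p \<epsilon> f \<longrightarrow> (\<exists>a. (a = \<alpha> \<or> a \<epsilon> \<alpha>) \<and> (\<exists>b. is_opair p a b))) \<and>
     (\<forall>a. a = \<alpha> \<or> a \<epsilon> \<alpha> \<longrightarrow> (\<exists>b. rel f a b \<and> (\<forall>c. rel f a c \<longrightarrow> c = b))) \<and>
     (\<forall>\<beta> v. rel f \<beta> v \<longrightarrow> \<Phi> f \<beta> v)" for \<alpha> f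
    unfolding attempt_def is_function_def Ex1_def by auto
  show "dfv (\<lambda>\<rho>. attempt \<Phi> (\<rho> 0) (\<rho> 1))"
    unfolding * by (intro dfv_intros dfb_subst3[OF step_dfv])
qed

lemma dfb_rec: "trm UNIV t \<Longrightarrow> trm UNIV u \<Longrightarrow> dfv (\<lambda>\<rho>. rec \<Phi> (t \<rho>) (u \<rho>))"
  by (rule dfb_subst2[where P = "rec \<Phi>"]) (unfold rec_def, intro dfv_intros dfb_attempt)

lemma attempt_total: "attempt \<Phi> \<alpha> f \<Longrightarrow> \<beta> \<epsilon> suc \<alpha> \<Longrightarrow> \<exists>!v. rel f \<beta> v"
  unfolding attempt_def is_function_iff by auto

text \<open>Attempts that agree below \<beta> satisfy the same step condition at \<beta> by
  locality, and that condition has a single solution.\<close>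

lemma attempt_agree:
  assumes f: "attempt \<Phi> \<alpha> f" and g: "attempt \<Phi> \<alpha>' g" and "\<beta> \<epsilon> suc \<alpha>" "\<beta> \<epsilon> suc \<alpha>'"
  shows "rel f \<beta> v \<longleftrightarrow> rel g \<beta> v"
proof -
  have o: "ordinal (suc \<alpha>)" "ordinal (suc \<alpha>')"
    using f g by (auto simp: attempt_def intro: ordinal_suc)
  have "\<beta> \<epsilon> suc \<alpha> \<and> \<beta> \<epsilon> suc \<alpha>' \<longrightarrow> (\<forall>v. rel f \<beta> v \<longleftrightarrow> rel g \<beta> v)"
  proof (rule ordinal_induct[where a = \<beta>])
    show "dfv (\<lambda>\<rho>. \<rho> 0 \<epsilon> suc \<alpha> \<and> \<rho> 0 \<epsilon> suc \<alpha>' \<longrightarrow> (\<forall>v. rel f (\<rho> 0) v \<longleftrightarrow> rel g (\<rho> 0) v))"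
      by (intro dfv_intros)
    show "ordinal \<beta>" using ordinal_mem o assms(3) by blast
  next
    fix \<beta> assume \<beta>: "ordinal \<beta>"
      and IH: "\<And>\<gamma>. \<gamma> \<epsilon> \<beta> \<Longrightarrow> \<gamma> \<epsilon> suc \<alpha> \<and> \<gamma> \<epsilon> suc \<alpha>' \<longrightarrow> (\<forall>v. rel f \<gamma> v \<longleftrightarrow> rel g \<gamma> v)"
    show "\<beta> \<epsilon> suc \<alpha> \<and> \<beta> \<epsilon> suc \<alpha>' \<longrightarrow> (\<forall>v. rel f \<beta> v \<longleftrightarrow> rel g \<beta> v)"
    proof
      assume b: "\<beta> \<epsilon> suc \<alpha> \<and> \<beta> \<epsilon> suc \<alpha>'"
      then have in_suc: "\<gamma> \<epsilon> suc \<alpha>" "\<gamma> \<epsilon> suc \<alpha>'" if "\<gamma> \<epsilon> \<beta>" for \<gamma>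
        using that ordinal_trans[OF o(1)] ordinal_trans[OF o(2)] by blast+
      then have eq: "rel f \<gamma> u \<longleftrightarrow> rel g \<gamma> u" if "\<gamma> \<epsilon> \<beta>" for \<gamma> u
        using IH that by blast
      obtain v w where v: "rel f \<beta> v" "rel g \<beta> w" using attempt_total f g b by blast
      then have "\<Phi> f \<beta> v" "\<Phi> g \<beta> w" using f g by (auto simp: attempt_def)
      then have "\<Phi> g \<beta> v" using step_local[OF eq] by blast
      moreover have "\<exists>!v. \<Phi> g \<beta> v" by (rule step_ex1[OF \<beta>]) (use in_suc attempt_total g in blast)
      ultimately have "v = w" using \<open>\<Phi> g \<beta> w\<close> by blast
      with v show "\<forall>v. rel f \<beta> v \<longleftrightarrow> rel g \<beta> v"
        using attempt_total f g b by metis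
    qed
  qed
  then show ?thesis using assms(3,4) by blast
qed

lemma rel_attempt_iff_rec:
  assumes f: "attempt \<Phi> \<alpha> f" and "\<beta> \<epsilon> suc \<alpha>" "\<exists>g. attempt \<Phi> \<beta> g"
  shows "rel f \<beta> v \<longleftrightarrow> rec \<Phi> \<beta> v"
  unfolding rec_def using attempt_agree[OF f _ assms(2), of \<beta>] assms(3) by auto

lemma attempt_exists: "ordinal \<alpha> \<Longrightarrow> \<exists>f. attempt \<Phi> \<alpha> f"
proof (rule ordinal_induct[where a = \<alpha> and Q = "\<lambda>\<alpha>. \<exists>f. attempt \<Phi> \<alpha> f"])
  show "dfv (\<lambda>\<rho>. \<exists>f. attempt \<Phi> (\<rho> 0) f)" by (intro dfv_intros dfb_attempt)
next
  fix \<alpha> assume \<alpha>: "ordinal \<alpha>" and IH: "\<And>\<beta>. \<beta> \<epsilon> \<alpha> \<Longrightarrow> \<exists>f. attempt \<Phi> \<beta> f"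
  have rec1: "\<exists>!v. rec \<Phi> \<beta> v" if b: "\<beta> \<epsilon> \<alpha>" for \<beta>
  proof -
    obtain f where f: "attempt \<Phi> \<beta> f" using IH[OF b] by blast
    have "rel f \<beta> v \<longleftrightarrow> rec \<Phi> \<beta> v" for v
      by (rule rel_attempt_iff_rec[OF f]) (use f in auto)
    then show ?thesis using attempt_total[OF f, of \<beta>] by simp
  qed
  let ?Y = "{v. \<exists>\<beta>. \<beta> \<epsilon> \<alpha> \<and> rec \<Phi> \<beta> v}"
  \<comment> \<open>Replacement gathers the values below \<alpha>; this set bounds the graph
    \<open>g\<close>, to which only the pair at \<alpha> is then added.\<close>
  have Y: "is_set ?Y" by (rule is_set_replace) (intro dfb_rec dfv_intros, fact rec1)
  have "\<exists>g. (\<forall>a b. rel g a b \<longleftrightarrow> a \<epsilon> \<alpha> \<and> rec \<Phi> a b) \<and>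
      (\<forall>p. p \<epsilon> g \<longrightarrow> (\<exists>a b. (a \<epsilon> \<alpha> \<and> rec \<Phi> a b) \<and> p = opr a b))"
  proof (rule ex_graph)
    show "dfv (\<lambda>\<rho>. \<rho> 0 \<epsilon> \<alpha> \<and> rec \<Phi> (\<rho> 0) (\<rho> 1))" by (intro dfv_intros dfb_rec)
    show "a \<epsilon> \<alpha> \<and> b \<epsilon> mk ?Y" if "a \<epsilon> \<alpha> \<and> rec \<Phi> a b" for a b
      using Y that by auto
  qed
  then obtain g where g: "\<And>a b. rel g a b \<longleftrightarrow> a \<epsilon> \<alpha> \<and> rec \<Phi> a b"
    "\<And>p. p \<epsilon> g \<Longrightarrow> \<exists>a b. (a \<epsilon> \<alpha> \<and> rec \<Phi> a b) \<and> p = opr a b" by blast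
  have "\<exists>!v. \<Phi> g \<alpha> v" by (rule step_ex1[OF \<alpha>]) (use g(1) rec1 in simp)
  then obtain v where v: "\<Phi> g \<alpha> v" by blast
  define f where "f = mk (insert (opr \<alpha> v) (ext g))"
  have mem_f: "p \<epsilon> f \<longleftrightarrow> p = opr \<alpha> v \<or> p \<epsilon> g" for p by (simp add: f_def)
  have rel_f: "rel f a b \<longleftrightarrow> a = \<alpha> \<and> b = v \<or> a \<epsilon> \<alpha> \<and> rec \<Phi> a b" for a b
    using g(1)[of a b] by (auto simp: rel_iff mem_f)
  have "attempt \<Phi> \<alpha> f" unfolding attempt_def is_function_iff
  proof (intro conjI allI impI ballI \<alpha>)
    fix p assume "p \<epsilon> f"
    then show "\<exists>a\<in>insert \<alpha> (ext \<alpha>). \<exists>b\<in>UNIV. p = opr a b" using g(2)[of p] by (auto simp: mem_f)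
  next
    fix a assume "a \<in> insert \<alpha> (ext \<alpha>)"
    then show "\<exists>!b. rel f a b" using rec1[of a] by (auto simp: rel_f)
  next
    fix \<beta> w assume "rel f \<beta> w"
    then consider "\<beta> = \<alpha>" "w = v" | "\<beta> \<epsilon> \<alpha>" "rec \<Phi> \<beta> w" unfolding rel_f by blast
    then show "\<Phi> f \<beta> w"
    proof cases
      case 1
      have "\<Phi> f \<alpha> v" by (rule step_local[OF _ v]) (auto simp: g(1) rel_f)
      with 1 show ?thesis by simp
    next
      case 2
      \<comment> \<open>Below \<alpha> the step condition is inherited from an attempt of length
        \<beta>, which has the same values as \<open>f\<close> below \<beta>.\<close>
      then obtain h where h: "attempt \<Phi> \<beta> h" "rel h \<beta> w" unfolding rec_def by blast
      show ?thesis
      proof (rule step_local)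
        show "\<Phi> h \<beta> w" using h by (simp add: attempt_def)
        fix \<gamma> u assume \<gamma>: "\<gamma> \<epsilon> \<beta>"
        then have "\<gamma> \<epsilon> \<alpha>" using 2 \<alpha> ordinal_trans by blast
        then show "rel h \<gamma> u \<longleftrightarrow> rel f \<gamma> u"
          using rel_attempt_iff_rec[OF h(1), of \<gamma>] \<gamma> IH by (auto simp: rel_f)
      qed
    qed
  qed
  then show "\<exists>f. attempt \<Phi> \<alpha> f" by blast
qed

lemma rec_ex1:
  assumes "ordinal \<beta>"
  shows "\<exists>!v. rec \<Phi> \<beta> v"
proof -
  obtain f where f: "attempt \<Phi> \<beta> f" using attempt_exists assms by blast
  have "rel f \<beta> v \<longleftrightarrow> rec \<Phi> \<beta> v" for v
    by (rule rel_attempt_iff_rec[OF f]) (use f in auto)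
  then show ?thesis using attempt_total[OF f, of \<beta>] by simp
qed

lemma rec_unfold:
  assumes "rec \<Phi> \<beta> v"
  obtains f where "\<Phi> f \<beta> v" "\<And>\<gamma> u. \<gamma> \<epsilon> \<beta> \<Longrightarrow> rel f \<gamma> u \<longleftrightarrow> rec \<Phi> \<gamma> u"
proof -
  obtain f where f: "attempt \<Phi> \<beta> f" "rel f \<beta> v" using assms unfolding rec_def by blast
  have "rel f \<gamma> u \<longleftrightarrow> rec \<Phi> \<gamma> u" if "\<gamma> \<epsilon> \<beta>" for \<gamma> u
    by (rule rel_attempt_iff_rec[OF f(1)])
      (use that f(1) attempt_exists ordinal_mem in \<open>auto simp: attempt_def\<close>)
  moreover have "\<Phi> f \<beta> v" using f by (simp add: attempt_def)
  ultimately show ?thesis using that by blast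
qed

end


subsection \<open>Definability inside the model\<close>

text \<open>The standard naturals inside the model. They index the variables of metatheoretic
  formulas, whereas assignments live on all of \<open>Omega\<close>.\<close>

primrec num :: "nat \<Rightarrow> 'a" where
  "num 0 = emp"
| "num (Suc n) = suc (num n)"

lemma num_Omega [simp]: "num i \<in> Omega"
  by (induction i) simp_all

lemma num_inject [simp]: "num i = num j \<longleftrightarrow> i = j"
proof (induction i arbitrary: j)
  case 0
  show ?case by (cases j) simp_all
next
  case (Suc i)
  then show ?case by (cases j) simp_all
qed

definition val :: "'a \<Rightarrow> nat \<Rightarrow> 'a" where
  "val s i = (THE a. rel s (num i) a)"

lemma assignment_iff: "assignment A s \<longleftrightarrow>
    (\<forall>p. p \<epsilon> s \<longrightarrow> (\<exists>i a. i \<in> Omega \<and> a \<epsilon> A \<and> p = opr i a)) \<and> (\<forall>i. i \<in> Omega \<longrightarrow> (\<exists>!a. rel s i a))"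
  unfolding assignment_def is_function_iff by auto

lemma rel_assignment: "assignment A s \<Longrightarrow> rel s i a \<Longrightarrow> a \<epsilon> A"
  unfolding assignment_iff rel_iff by fastforce

lemma rel_num: "assignment A s \<Longrightarrow> rel s (num i) a \<longleftrightarrow> a = val s i"
  unfolding val_def assignment_iff using theI'[of "\<lambda>a. rel s (num i) a"] num_Omega by blast

lemma dfb_assignment: "trm UNIV t \<Longrightarrow> trm UNIV u \<Longrightarrow> dfv (\<lambda>\<rho>. assignment (t \<rho>) (u \<rho>))"
  by (rule dfb_subst2[where P = assignment])
    (unfold assignment_def is_function_def Ball_def Bex_def Ex1_def in_ext, intro dfv_intros)

lemma ex_assignment_graph:
  assumes "dfv (\<lambda>\<rho>. Q (\<rho> 0) (\<rho> 1))" "\<And>i. i \<in> Omega \<Longrightarrow> \<exists>!a. Q i a"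
    "\<And>i a. Q i a \<Longrightarrow> i \<in> Omega \<and> a \<epsilon> A"
  shows "\<exists>s. assignment A s \<and> (\<forall>i a. rel s i a \<longleftrightarrow> Q i a)"
proof -
  have "\<exists>f. (\<forall>a b. rel f a b \<longleftrightarrow> Q a b) \<and> (\<forall>p. p \<epsilon> f \<longrightarrow> (\<exists>a b. Q a b \<and> p = opr a b))"
    by (rule ex_graph[where x = omega and y = A, OF assms(1)]) (use assms(3) in simp)
  then obtain f where "\<And>a b. rel f a b \<longleftrightarrow> Q a b" "\<And>p. p \<epsilon> f \<Longrightarrow> \<exists>a b. Q a b \<and> p = opr a b" by blast
  then show ?thesis using assms(2,3) by (intro exI[of _ f]) (simp add: assignment_iff, blast)
qed

lemma ex_update:
  assumes "assignment A s" "i \<in> Omega" "a \<epsilon> A"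
  shows "\<exists>t. is_update A s i a t"
proof -
  let ?Q = "\<lambda>j b. j = i \<and> b = a \<or> j \<noteq> i \<and> j \<in> Omega \<and> rel s j b"
  have "\<exists>t. assignment A t \<and> (\<forall>j b. rel t j b \<longleftrightarrow> ?Q j b)"
  proof (rule ex_assignment_graph)
    show "dfv (\<lambda>\<rho>. \<rho> 0 = i \<and> \<rho> 1 = a \<or> \<rho> 0 \<noteq> i \<and> \<rho> 0 \<in> Omega \<and> rel s (\<rho> 0) (\<rho> 1))"
      by (intro dfv_intros)
    show "\<exists>!b. ?Q j b" if "j \<in> Omega" for j
      using assms(1) that unfolding assignment_iff by (cases "j = i") auto
    show "j \<in> Omega \<and> b \<epsilon> A" if "?Q j b" for j b
      using that assms rel_assignment by blast
  qed
  then show ?thesis unfolding is_update_def by auto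
qed

lemma val_update:
  assumes "is_update A s (num i) a t" "assignment A s"
  shows "val t = (val s)(i := a)"
proof
  fix j
  have t: "assignment A t" "rel t (num i) a" using assms(1) by (auto simp: is_update_def)
  show "val t j = ((val s)(i := a)) j"
  proof (cases "j = i")
    case True
    then show ?thesis using t rel_num by auto
  next
    case False
    then have "rel t (num j) b \<longleftrightarrow> rel s (num j) b" for b
      using assms(1) unfolding is_update_def by simp
    then show ?thesis using False rel_num[OF t(1), of j "val t j"] rel_num[OF assms(2), of j "val t j"] by simp
  qed
qed

text \<open>Assignments are subsets of a set of pairs, hence elements of a power set.\<close>

lemma is_set_assignments:
  assumes "dfv (\<lambda>\<rho>. Q (\<rho> 0))"
  shows "is_set {s. assignment A s \<and> Q s}"
proof -
  obtain q where q: "\<And>i a. i \<epsilon> omega \<Longrightarrow> a \<epsilon> A \<Longrightarrow> opr i a \<epsilon> q" using pair_bound by blast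
  show ?thesis
  proof (rule is_set_sep)
    show "dfv (\<lambda>\<rho>. assignment A (\<rho> 0) \<and> Q (\<rho> 0))" by (intro dfv_intros dfb_assignment assms)
    fix s assume s: "assignment A s \<and> Q s"
    have "ext s \<subseteq> ext q"
    proof
      fix p assume "p \<in> ext s"
      then obtain i a where "i \<in> Omega" "a \<epsilon> A" "p = opr i a" using s unfolding assignment_iff by auto
      then show "p \<in> ext q" using q by simp
    qed
    then show "s \<epsilon> mk {z. ext z \<subseteq> ext q}" by simp
  qed
qed

lemma dfb_is_update:
  "trm UNIV t \<Longrightarrow> trm UNIV u \<Longrightarrow> trm UNIV v \<Longrightarrow> trm UNIV w \<Longrightarrow> trm UNIV x \<Longrightarrow>
    dfv (\<lambda>\<rho>. is_update (t \<rho>) (u \<rho>) (v \<rho>) (w \<rho>) (x \<rho>))"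
  by (rule dfb_subst5[where P = is_update])
    (unfold is_update_def Ball_def, intro dfv_intros dfb_assignment)

section \<open>Metatheoretic formulas as definable relations of the model\<close>

lemma definable_relation_mem:
  assumes "ext R = {s. assignment A s \<and> (\<exists>a b. rel s i a \<and> rel s j b \<and> a \<epsilon> b)}" "i \<in> Omega" "j \<in> Omega"
  shows "definable_relation r A R"
  unfolding definable_relation_def
proof (intro allI impI)
  fix F assume "definability_closed r A F"
  then have "\<forall>R. \<forall>i\<in>Omega. \<forall>j\<in>Omega.
        ext R = {s. assignment A s \<and> (\<exists>a b. rel s i a \<and> rel s j b \<and> a \<epsilon> b)} \<longrightarrow> R \<epsilon> F"
    unfolding definability_closed_def by (elim conjE)
  with assms show "R \<epsilon> F" by blast
qed

lemma definable_relation_eq: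
  assumes "ext R = {s. assignment A s \<and> (\<exists>a. rel s i a \<and> rel s j a)}" "i \<in> Omega" "j \<in> Omega"
  shows "definable_relation r A R"
  unfolding definable_relation_def
proof (intro allI impI)
  fix F assume "definability_closed r A F"
  then have "\<forall>R. \<forall>i\<in>Omega. \<forall>j\<in>Omega.
        ext R = {s. assignment A s \<and> (\<exists>a. rel s i a \<and> rel s j a)} \<longrightarrow> R \<epsilon> F"
    unfolding definability_closed_def by (elim conjE)
  with assms show "R \<epsilon> F" by blast
qed

lemma definable_relation_compl:
  assumes "definable_relation r A S" "ext R = {s. assignment A s \<and> \<not> s \<epsilon> S}"
  shows "definable_relation r A R"
  unfolding definable_relation_def
proof (intro allI impI)
  fix F assume F: "definability_closed r A F"
  then have "\<forall>R S. S \<epsilon> F \<longrightarrow> ext R = {s. assignment A s \<and> \<not> s \<epsilon> S} \<longrightarrow> R \<epsilon> F"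
    unfolding definability_closed_def by (elim conjE)
  with F assms show "R \<epsilon> F" unfolding definable_relation_def by blast
qed

lemma definable_relation_inter:
  assumes "definable_relation r A S" "definable_relation r A T" "ext R = ext S \<inter> ext T"
  shows "definable_relation r A R"
  unfolding definable_relation_def
proof (intro allI impI)
  fix F assume F: "definability_closed r A F"
  then have "\<forall>R S T. S \<epsilon> F \<longrightarrow> T \<epsilon> F \<longrightarrow> ext R = ext S \<inter> ext T \<longrightarrow> R \<epsilon> F"
    unfolding definability_closed_def by (elim conjE)
  with F assms show "R \<epsilon> F" unfolding definable_relation_def by blast
qed

lemma definable_relation_proj:
  assumes "definable_relation r A S" "i \<in> Omega"
    "ext R = {s. assignment A s \<and> (\<exists>a t. a \<epsilon> A \<and> is_update A s i a t \<and> t \<epsilon> S)}"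
  shows "definable_relation r A R"
  unfolding definable_relation_def
proof (intro allI impI)
  fix F assume F: "definability_closed r A F"
  then have "\<forall>R S. \<forall>i\<in>Omega. S \<epsilon> F \<longrightarrow>
        ext R = {s. assignment A s \<and> (\<exists>a t. a \<epsilon> A \<and> is_update A s i a t \<and> t \<epsilon> S)} \<longrightarrow> R \<epsilon> F"
    unfolding definability_closed_def by (elim conjE)
  with F assms show "R \<epsilon> F" unfolding definable_relation_def by blast
qed

lemma ex_definable_relation_compl:
  assumes "definable_relation r A S"
  shows "\<exists>R. ext R = {s. assignment A s \<and> \<not> s \<epsilon> S} \<and> definable_relation r A R"
proof -
  have "is_set {s. assignment A s \<and> \<not> s \<epsilon> S}"
    by (rule is_set_assignments) (intro dfv_intros)
  then obtain R where R: "ext R = {s. assignment A s \<and> \<not> s \<epsilon> S}" unfolding is_set_def by blast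
  with definable_relation_compl[OF assms R] show ?thesis by blast
qed

text \<open>The bridge between the two kinds of formulas: an external induction over
  \<open>fm\<close> that matches each constructor with closure operations on definable
  relations.\<close>

lemma fm_relation:
  "\<exists>R. ext R = {s. assignment A s \<and> sat (ext A) (val s) \<phi>} \<and> definable_relation r A R"
proof (induction \<phi>)
  case (Mem i j)
  let ?S = "{s. assignment A s \<and> (\<exists>a b. rel s (num i) a \<and> rel s (num j) b \<and> a \<epsilon> b)}"
  have "is_set ?S"
    by (rule is_set_assignments) (intro dfv_intros)
  then obtain R where R: "ext R = ?S" unfolding is_set_def by blast
  have "?S = {s. assignment A s \<and> sat (ext A) (val s) (Mem i j)}"
    using rel_num by auto
  with R definable_relation_mem[OF R] show ?case by auto
next
  case (Eq i j)
  let ?S = "{s. assignment A s \<and> (\<exists>a. rel s (num i) a \<and> rel s (num j) a)}"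
  have "is_set ?S"
    by (rule is_set_assignments) (intro dfv_intros)
  then obtain R where R: "ext R = ?S" unfolding is_set_def by blast
  have "?S = {s. assignment A s \<and> sat (ext A) (val s) (Eq i j)}"
    using rel_num by auto
  with R definable_relation_eq[OF R] show ?case by auto
next
  case (Neg \<phi>)
  then obtain S where S: "ext S = {s. assignment A s \<and> sat (ext A) (val s) \<phi>}"
    "definable_relation r A S" by blast
  obtain R where "ext R = {s. assignment A s \<and> \<not> s \<in> ext S}" "definable_relation r A R"
    using ex_definable_relation_compl[OF S(2)] unfolding in_ext by blast
  then show ?case unfolding S(1) by (intro exI[of _ R]) auto
next
  case (Imp \<phi> \<psi>)
  then obtain S T where S: "ext S = {s. assignment A s \<and> sat (ext A) (val s) \<phi>}"
    "definable_relation r A S"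
    and T: "ext T = {s. assignment A s \<and> sat (ext A) (val s) \<psi>}" "definable_relation r A T" by blast
  \<comment> \<open>An implication is the complement of the intersection of its premise with the
    negated conclusion.\<close>
  obtain T' where T': "ext T' = {s. assignment A s \<and> \<not> s \<in> ext T}" "definable_relation r A T'"
    using ex_definable_relation_compl[OF T(2)] unfolding in_ext by blast
  have "is_set {s. assignment A s \<and> s \<epsilon> S \<and> s \<epsilon> T'}"
    by (rule is_set_assignments) (intro dfv_intros)
  moreover have "{s. assignment A s \<and> s \<epsilon> S \<and> s \<epsilon> T'} = ext S \<inter> ext T'"
  proof -
    have "assignment A s" if "s \<in> ext S" for s using that unfolding S(1) by blast
    then show ?thesis by auto
  qed
  ultimately have "is_set (ext S \<inter> ext T')" by (simp only:)
  then obtain I where I: "ext I = ext S \<inter> ext T'" unfolding is_set_def by blast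
  obtain R where "ext R = {s. assignment A s \<and> \<not> s \<in> ext I}" "definable_relation r A R"
    using ex_definable_relation_compl[OF definable_relation_inter[OF S(2) T'(2) I]]
    unfolding in_ext by blast
  then show ?case unfolding I T'(1) S(1) T(1) by (intro exI[of _ R]) auto
next
  case (All i \<phi>)
  then obtain S where S: "ext S = {s. assignment A s \<and> sat (ext A) (val s) \<phi>}"
    "definable_relation r A S" by blast
  obtain S' where S': "ext S' = {s. assignment A s \<and> \<not> s \<in> ext S}" "definable_relation r A S'"
    using ex_definable_relation_compl[OF S(2)] unfolding in_ext by blast
  \<comment> \<open>A universal quantifier is the complement of the projection of the
    complement.\<close>
  let ?T = "{s. assignment A s \<and> (\<exists>a t. a \<epsilon> A \<and> is_update A s (num i) a t \<and> t \<epsilon> S')}"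
  have "is_set ?T"
    by (rule is_set_assignments) (intro dfv_intros dfb_is_update)
  then obtain T where T: "ext T = ?T" unfolding is_set_def by blast
  have "definable_relation r A T"
    by (rule definable_relation_proj[OF S'(2) num_Omega[of i]]) (rule T)
  then obtain R where R: "ext R = {s. assignment A s \<and> \<not> s \<in> ext T}" "definable_relation r A R"
    using ex_definable_relation_compl[of r A T]
    unfolding in_ext by blast
  have S'_iff: "t \<epsilon> S' \<longleftrightarrow> assignment A t \<and> \<not> sat (ext A) (val t) \<phi>" for t
  proof -
    have "t \<epsilon> S' \<longleftrightarrow> t \<in> ext S'" by simp
    then show ?thesis unfolding S'(1) S(1) by blast
  qed
  have "s \<in> ext T \<longleftrightarrow> \<not> sat (ext A) (val s) (All i \<phi>)" if s: "assignment A s" for s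
  proof -
    have "(\<exists>t. is_update A s (num i) a t \<and> t \<epsilon> S') \<longleftrightarrow> \<not> sat (ext A) ((val s)(i := a)) \<phi>" if a: "a \<epsilon> A" for a
    proof -
      obtain t where t: "is_update A s (num i) a t" using ex_update[OF s num_Omega a] by blast
      have "assignment A t'" "val t' = (val s)(i := a)" if "is_update A s (num i) a t'" for t'
        using that val_update[OF that s] by (auto simp: is_update_def)
      then show ?thesis unfolding S'_iff using t by metis
    qed
    then show ?thesis unfolding T using s by auto
  qed
  then have "{s. assignment A s \<and> \<not> s \<in> ext T} = {s. assignment A s \<and> sat (ext A) (val s) (All i \<phi>)}"
    by blast
  with R show ?case by auto
qed

text \<open>The external sequence \<sigma> need not be represented by a set of the model, so only an
  initial segment of it is realized, by finitely many updates.\<close>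

lemma ex_assignment:
  assumes "range \<sigma> \<subseteq> ext A"
  shows "\<exists>s. assignment A s \<and> (\<forall>i<n. val s i = \<sigma> i)"
proof (induction n)
  case 0
  have "\<sigma> 0 \<epsilon> A" using assms in_ext by blast
  have "\<exists>s. assignment A s \<and> (\<forall>j b. rel s j b \<longleftrightarrow> j \<in> Omega \<and> b = \<sigma> 0)"
  proof (rule ex_assignment_graph)
    show "dfv (\<lambda>\<rho>. \<rho> 0 \<in> Omega \<and> \<rho> 1 = \<sigma> 0)" by (intro dfv_intros)
  qed (use \<open>\<sigma> 0 \<epsilon> A\<close> in auto)
  then show ?case by auto
next
  case (Suc n)
  then obtain s where s: "assignment A s" "\<forall>i<n. val s i = \<sigma> i" by blast
  have "\<sigma> n \<epsilon> A" using assms in_ext by blast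
  then obtain t where t: "is_update A s (num n) (\<sigma> n) t"
    using ex_update[OF s(1) num_Omega] by blast
  then have "assignment A t" by (simp add: is_update_def)
  moreover have "\<forall>i<Suc n. val t i = \<sigma> i" unfolding val_update[OF t s(1)]
    using s(2) by (auto simp: less_Suc_eq)
  ultimately show ?case by blast
qed

lemma definable_subset_fm:
  assumes \<sigma>: "range \<sigma> \<subseteq> ext A" and X: "ext X = {a. a \<epsilon> A \<and> sat (ext A) (\<sigma>(0 := a)) \<phi>}"
  shows "definable_subset r A X"
proof -
  \<comment> \<open>Only finitely many variables occur in the formula, so agreement with \<sigma>
    below \<open>n\<close> is enough.\<close>
  obtain n where n: "\<forall>i\<in>fv \<phi>. i < n"
    using finite_nat_set_iff_bounded finite_fv by blast
  obtain s where s: "assignment A s" "\<forall>i<n. val s i = \<sigma> i"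
    using ex_assignment[OF \<sigma>] by blast
  obtain R where R: "ext R = {s. assignment A s \<and> sat (ext A) (val s) \<phi>}" "definable_relation r A R"
    using fm_relation by blast
  have "sat (ext A) (\<sigma>(0 := a)) \<phi> \<longleftrightarrow> (\<exists>t. is_update A s (num 0) a t \<and> t \<epsilon> R)" if a: "a \<epsilon> A" for a
  proof -
    have eq: "sat (ext A) ((val s)(0 := a)) \<phi> \<longleftrightarrow> sat (ext A) (\<sigma>(0 := a)) \<phi>"
      by (rule sat_cong) (use s(2) n in simp)
    obtain t where t: "is_update A s (num 0) a t" using ex_update[OF s(1) num_Omega a] by blast
    have "t' \<epsilon> R \<longleftrightarrow> sat (ext A) (\<sigma>(0 := a)) \<phi>" if "is_update A s (num 0) a t'" for t'
    proof -
      have "assignment A t'" using that by (simp add: is_update_def)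
      moreover have "t' \<epsilon> R \<longleftrightarrow> t' \<in> ext R" by simp
      ultimately show ?thesis unfolding R(1) mem_Collect_eq val_update[OF that s(1)] eq by blast
    qed
    then show ?thesis using t by blast
  qed
  then have "ext X = {a. a \<epsilon> A \<and> (\<exists>t. is_update A s (num 0) a t \<and> t \<epsilon> R)}"
    unfolding X by blast
  then show ?thesis unfolding definable_subset_def using R(2) s(1) num_Omega by blast
qed

lemma definable_subset_dfb:
  assumes "dfb (ext A) (ext A) (\<lambda>\<rho>. Q (\<rho> 0))" "trans_class (ext A)" "ext X = {a. a \<epsilon> A \<and> Q a}"
  shows "definable_subset r A X"
proof (cases "ext A = {}")
  case True
  then have "is_empty X" using assms(3) unfolding is_empty_def by auto
  then show ?thesis by (simp add: definable_subset_def)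
next
  case False
  then obtain \<phi> \<sigma> where \<phi>: "range \<sigma> \<subseteq> ext A" "\<forall>a\<in>ext A. Q a \<longleftrightarrow> sat (ext A) (\<sigma>(0 := a)) \<phi>"
    using dfb_sat1[OF assms(1) subset_refl assms(2)] by blast
  then have "ext X = {a. a \<epsilon> A \<and> sat (ext A) (\<sigma>(0 := a)) \<phi>}" unfolding assms(3) by auto
  with \<phi>(1) show ?thesis by (rule definable_subset_fm)
qed

lemma definable_subset_subset: "definable_subset r A X \<Longrightarrow> ext X \<subseteq> ext A"
  unfolding definable_subset_def is_empty_def by auto

lemma dfb_definability_closed:
  "trm UNIV t \<Longrightarrow> trm UNIV u \<Longrightarrow> trm UNIV v \<Longrightarrow> dfv (\<lambda>\<rho>. definability_closed (t \<rho>) (u \<rho>) (v \<rho>))"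
  by (rule dfb_subst3[where P = definability_closed])
    (unfold definability_closed_def Ball_def set_eq_iff in_ext mem_Collect_eq Int_iff,
      intro dfv_intros dfb_assignment dfb_is_update)

lemma dfb_definable_relation:
  "trm UNIV t \<Longrightarrow> trm UNIV u \<Longrightarrow> trm UNIV v \<Longrightarrow> dfv (\<lambda>\<rho>. definable_relation (t \<rho>) (u \<rho>) (v \<rho>))"
  by (rule dfb_subst3[where P = definable_relation])
    (unfold definable_relation_def, intro dfv_intros dfb_definability_closed)

lemma dfb_definable_subset:
  "trm UNIV t \<Longrightarrow> trm UNIV u \<Longrightarrow> trm UNIV v \<Longrightarrow> dfv (\<lambda>\<rho>. definable_subset (t \<rho>) (u \<rho>) (v \<rho>))"
  by (rule dfb_subst3[where P = definable_subset])
    (unfold definable_subset_def Bex_def set_eq_iff in_ext mem_Collect_eq,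
      intro dfv_intros dfb_definable_relation dfb_assignment dfb_is_update)

lemma is_set_definable_subsets: "is_set {X. definable_subset r A X}"
proof (rule is_set_sep)
  show "dfv (\<lambda>\<rho>. definable_subset r A (\<rho> 0))" by (intro dfv_intros dfb_definable_subset)
  show "X \<epsilon> mk {z. ext z \<subseteq> ext A}" if "definable_subset r A X" for X
    using definable_subset_subset[OF that] by simp
qed


subsection \<open>The levels of the constructible hierarchy\<close>

text \<open>The recursion clause of \<open>is_hierarchy\<close> taken by itself, so that hierarchies
  are exactly its attempts.\<close>

definition level_step :: "'a \<Rightarrow> 'a \<Rightarrow> 'a \<Rightarrow> 'a \<Rightarrow> bool" where
  "level_step r f \<beta> v \<longleftrightarrow>
     (is_empty \<beta> \<longrightarrow> is_empty v) \<and>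
     (\<forall>\<gamma> u. is_succ \<beta> \<gamma> \<longrightarrow> rel f \<gamma> u \<longrightarrow> ext v = {X. definable_subset r u X}) \<and>
     (limit \<beta> \<longrightarrow> ext v = {X. \<exists>\<gamma> u. \<gamma> \<epsilon> \<beta> \<and> rel f \<gamma> u \<and> X \<epsilon> u})"

definition lev :: "'a \<Rightarrow> 'a \<Rightarrow> 'a" where
  "lev r \<beta> = (THE v. rec (level_step r) \<beta> v)"

lemma dfb_level_step: "dfv (\<lambda>\<rho>. level_step r (\<rho> 0) (\<rho> 1) (\<rho> 2))"
  unfolding level_step_def set_eq_iff in_ext mem_Collect_eq
  by (intro dfv_intros dfb_definable_subset)

lemma level_step_ex1:
  assumes "ordinal \<beta>" and f: "\<And>\<gamma>. \<gamma> \<epsilon> \<beta> \<Longrightarrow> \<exists>!u. rel f \<gamma> u"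
  shows "\<exists>!v. level_step r f \<beta> v"
proof -
  have ex1: "\<exists>!v. ext v = S" if "is_set S" for S
    using that unfolding is_set_def by (metis ext_inject)
  from assms(1) show ?thesis
  proof (cases rule: ordinal_cases)
    case 1
    then show ?thesis by (simp add: level_step_def)
  next
    case (2 b)
    then obtain u where u: "rel f b v \<longleftrightarrow> v = u" for v using f by metis
    have "level_step r f \<beta> v \<longleftrightarrow> ext v = {X. definable_subset r u X}" for v
      using 2(1) u by (simp add: level_step_def)
    with ex1[OF is_set_definable_subsets] show ?thesis by simp
  next
    case 3
    let ?U = "{u. \<exists>\<gamma>. \<gamma> \<epsilon> \<beta> \<and> rel f \<gamma> u}"
    \<comment> \<open>The earlier levels form a set by replacement, and the limit level is its
      union.\<close>
    have U: "is_set ?U" by (rule is_set_replace) (intro dfv_intros, fact f)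
    have "(\<Union>u\<in>ext (mk ?U). ext u) = {X. \<exists>\<gamma> u. \<gamma> \<epsilon> \<beta> \<and> rel f \<gamma> u \<and> X \<epsilon> u}"
      unfolding ext_mk[OF U] UN_iff set_eq_iff by (simp only: in_ext mem_Collect_eq Bex_def) blast
    then have "is_set {X. \<exists>\<gamma> u. \<gamma> \<epsilon> \<beta> \<and> rel f \<gamma> u \<and> X \<epsilon> u}"
      using is_set_Union[of "mk ?U"] by (simp only:)
    moreover have "level_step r f \<beta> v \<longleftrightarrow> ext v = {X. \<exists>\<gamma> u. \<gamma> \<epsilon> \<beta> \<and> rel f \<gamma> u \<and> X \<epsilon> u}" for v
      using 3 unfolding level_step_def by auto
    ultimately show ?thesis using ex1 by simp
  qed
qed

lemma level_step_local:
  assumes "\<And>\<gamma> u. \<gamma> \<epsilon> \<beta> \<Longrightarrow> rel f \<gamma> u \<longleftrightarrow> rel g \<gamma> u" "level_step r f \<beta> v"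
  shows "level_step r g \<beta> v"
proof -
  have "{X. \<exists>\<gamma> u. \<gamma> \<epsilon> \<beta> \<and> rel f \<gamma> u \<and> X \<epsilon> u} = {X. \<exists>\<gamma> u. \<gamma> \<epsilon> \<beta> \<and> rel g \<gamma> u \<and> X \<epsilon> u}"
    using assms(1) by blast
  moreover have "rel f \<gamma> u \<longleftrightarrow> rel g \<gamma> u" if "is_succ \<beta> \<gamma>" for \<gamma> u
    using assms(1)[of \<gamma>] that by simp
  ultimately show ?thesis using assms(2) unfolding level_step_def by simp
qed

lemma step_relation_level_step: "step_relation (level_step r)"
  unfolding step_relation_def
proof (intro conjI allI impI dfb_level_step)
  show "\<exists>!v. level_step r f \<beta> v" if "ordinal \<beta>" "\<forall>\<gamma>. \<gamma> \<epsilon> \<beta> \<longrightarrow> (\<exists>!u. rel f \<gamma> u)" for f \<beta>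
    by (rule level_step_ex1) (use that in blast)+
  show "level_step r g \<beta> v"
    if "\<forall>\<gamma> u. \<gamma> \<epsilon> \<beta> \<longrightarrow> (rel f \<gamma> u \<longleftrightarrow> rel g \<gamma> u)" "level_step r f \<beta> v" for f g \<beta> v
    by (rule level_step_local[OF _ that(2)]) (use that(1) in blast)
qed

lemma rec_level_iff: "rec (level_step r) \<beta> v \<longleftrightarrow> ordinal \<beta> \<and> v = lev r \<beta>"
proof (cases "ordinal \<beta>")
  case True
  then have "\<exists>!v. rec (level_step r) \<beta> v"
    by (rule rec_ex1[OF step_relation_level_step])
  with True show ?thesis unfolding lev_def by (metis theI')
qed (auto simp: rec_def attempt_def)

lemma lev_step:
  assumes "ordinal \<beta>"
  shows "\<exists>f. level_step r f \<beta> (lev r \<beta>) \<and> (\<forall>\<gamma> u. \<gamma> \<epsilon> \<beta> \<longrightarrow> (rel f \<gamma> u \<longleftrightarrow> u = lev r \<gamma>))"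
proof -
  have "rec (level_step r) \<beta> (lev r \<beta>)" using assms rec_level_iff by blast
  then obtain f where f: "level_step r f \<beta> (lev r \<beta>)"
    "\<And>\<gamma> u. \<gamma> \<epsilon> \<beta> \<Longrightarrow> rel f \<gamma> u \<longleftrightarrow> rec (level_step r) \<gamma> u"
    using rec_unfold[OF step_relation_level_step] by blast
  then show ?thesis using ordinal_mem[OF assms] rec_level_iff by blast
qed

lemma lev_emp: "lev r emp = emp"
  using lev_step[OF ordinal_emp, of r] unfolding level_step_def by (metis is_empty_iff)

lemma lev_suc:
  assumes "ordinal \<beta>"
  shows "X \<epsilon> lev r (suc \<beta>) \<longleftrightarrow> definable_subset r (lev r \<beta>) X"
proof -
  obtain f where f: "level_step r f (suc \<beta>) (lev r (suc \<beta>))"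
    "\<forall>\<gamma> u. \<gamma> \<epsilon> suc \<beta> \<longrightarrow> (rel f \<gamma> u \<longleftrightarrow> u = lev r \<gamma>)"
    using lev_step[OF ordinal_suc[OF assms]] by blast
  have "ext (lev r (suc \<beta>)) = {X. definable_subset r (lev r \<beta>) X}"
    using f(1) f(2) unfolding level_step_def by simp
  then show ?thesis using in_ext by blast
qed

lemma lev_limit:
  assumes "limit \<beta>"
  shows "X \<epsilon> lev r \<beta> \<longleftrightarrow> (\<exists>\<gamma>. \<gamma> \<epsilon> \<beta> \<and> X \<epsilon> lev r \<gamma>)"
proof -
  have "ordinal \<beta>" using assms by (simp add: limit_def)
  then obtain f where f: "level_step r f \<beta> (lev r \<beta>)"
    "\<forall>\<gamma> u. \<gamma> \<epsilon> \<beta> \<longrightarrow> (rel f \<gamma> u \<longleftrightarrow> u = lev r \<gamma>)"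
    using lev_step by blast
  have "ext (lev r \<beta>) = {X. \<exists>\<gamma> u. \<gamma> \<epsilon> \<beta> \<and> rel f \<gamma> u \<and> X \<epsilon> u}"
    using f(1) assms unfolding level_step_def by blast
  then have "X \<epsilon> lev r \<beta> \<longleftrightarrow> (\<exists>\<gamma> u. \<gamma> \<epsilon> \<beta> \<and> rel f \<gamma> u \<and> X \<epsilon> u)" using in_ext by blast
  also have "\<dots> \<longleftrightarrow> (\<exists>\<gamma>. \<gamma> \<epsilon> \<beta> \<and> X \<epsilon> lev r \<gamma>)" using f(2) by metis
  finally show ?thesis .
qed

lemma L_iff: "x \<in> L r \<longleftrightarrow> (\<exists>\<alpha>. ordinal \<alpha> \<and> x \<epsilon> lev r \<alpha>)"
proof -
  have "is_hierarchy r \<alpha> f \<longleftrightarrow> attempt (level_step r) \<alpha> f" for \<alpha> f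
    unfolding is_hierarchy_def attempt_def level_step_def ..
  then have "x \<in> L r \<longleftrightarrow> (\<exists>\<alpha> v. rec (level_step r) \<alpha> v \<and> x \<epsilon> v)"
    unfolding L_def rec_def by blast
  then show ?thesis unfolding rec_level_iff by blast
qed

lemma dfb_rec_level: "trm UNIV t \<Longrightarrow> trm UNIV u \<Longrightarrow> dfv (\<lambda>\<rho>. rec (level_step r) (t \<rho>) (u \<rho>))"
  by (rule dfb_rec[OF step_relation_level_step])

text \<open>Outside the ordinals \<open>lev\<close> has an unspecified value. The formula goes
  through \<open>rec\<close>, which holds at ordinals only, and the conjunct \<open>ordinal\<close>
  records this.\<close>

lemma dfb_lev: "trm UNIV t \<Longrightarrow> trm UNIV u \<Longrightarrow> dfv (\<lambda>\<rho>. ordinal (u \<rho>) \<and> t \<rho> \<epsilon> lev r (u \<rho>))"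
proof (rule dfb_subst2[where P = "\<lambda>x \<alpha>. ordinal \<alpha> \<and> x \<epsilon> lev r \<alpha>"])
  have *: "ordinal \<alpha> \<and> x \<epsilon> lev r \<alpha> \<longleftrightarrow> (\<exists>v. rec (level_step r) \<alpha> v \<and> x \<epsilon> v)" for x \<alpha>
    unfolding rec_level_iff by blast
  show "dfv (\<lambda>\<rho>. ordinal (\<rho> 1) \<and> \<rho> 0 \<epsilon> lev r (\<rho> 1))"
    unfolding * by (intro dfv_intros dfb_rec_level)
qed

lemma dfb_L: "trm UNIV t \<Longrightarrow> dfv (\<lambda>\<rho>. t \<rho> \<in> L r)"
  by (rule dfb_subst1[where P = "\<lambda>x. x \<in> L r"]) (unfold L_iff, intro dfb_ex dfb_lev dfv_intros)

text \<open>An element of a transitive set is defined over it by membership in that element as a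
  parameter; hence each level is included in the next.\<close>

lemma definable_subset_self:
  assumes "trans_class (ext A)" "x \<epsilon> A"
  shows "definable_subset r A x"
proof (rule definable_subset_dfb[OF _ assms(1)])
  show "dfb (ext A) (ext A) (\<lambda>\<rho>. \<rho> 0 \<epsilon> x)" by (intro dfb_delta0) (simp add: assms(2))
  have "a \<epsilon> A" if "a \<epsilon> x" for a using assms that unfolding trans_class_def in_ext subset_eq Ball_ext by blast
  then show "ext x = {a. a \<epsilon> A \<and> a \<epsilon> x}" by auto
qed

lemma lev_properties:
  assumes "ordinal \<alpha>"
  shows "(\<forall>x y. x \<epsilon> lev r \<alpha> \<longrightarrow> y \<epsilon> x \<longrightarrow> y \<epsilon> lev r \<alpha>) \<and>
    (\<forall>\<beta> x. \<beta> \<epsilon> \<alpha> \<longrightarrow> x \<epsilon> lev r \<beta> \<longrightarrow> x \<epsilon> lev r \<alpha>)"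
proof -
  \<comment> \<open>Transitivity and monotonicity go through one induction, since inclusion of a
    level in its successor uses its transitivity. The conjuncts \<open>ordinal\<close> bring both
    into the form that \<open>dfb_lev\<close> handles.\<close>
  let ?T = "\<lambda>\<alpha>. \<forall>x y. (ordinal \<alpha> \<and> x \<epsilon> lev r \<alpha>) \<longrightarrow> y \<epsilon> x \<longrightarrow> (ordinal \<alpha> \<and> y \<epsilon> lev r \<alpha>)"
  let ?M = "\<lambda>\<alpha>. \<forall>\<beta> x. \<beta> \<epsilon> \<alpha> \<longrightarrow> (ordinal \<beta> \<and> x \<epsilon> lev r \<beta>) \<longrightarrow> (ordinal \<alpha> \<and> x \<epsilon> lev r \<alpha>)"
  have "?T \<alpha> \<and> ?M \<alpha>"
  proof (rule ordinal_induct[where Q = "\<lambda>\<alpha>. ?T \<alpha> \<and> ?M \<alpha>", OF _ _ assms])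
    show "dfv (\<lambda>\<rho>. ?T (\<rho> 0) \<and> ?M (\<rho> 0))"
      by (intro dfb_lev dfb_conj dfb_imp dfb_all dfb_mem trm_var)
  next
    fix \<alpha> assume \<alpha>: "ordinal \<alpha>" and IH: "\<And>\<beta>. \<beta> \<epsilon> \<alpha> \<Longrightarrow> ?T \<beta> \<and> ?M \<beta>"
    from \<alpha> show "?T \<alpha> \<and> ?M \<alpha>"
    proof (cases rule: ordinal_cases)
      case 1
      then show ?thesis by (simp add: lev_emp)
    next
      case (2 b)
      have T: "y \<epsilon> lev r b" if "x \<epsilon> lev r b" "y \<epsilon> x" for x y
        using IH[of b] 2 that by blast
      then have tr: "trans_class (ext (lev r b))" unfolding trans_class_def by auto
      have sub: "x \<epsilon> lev r \<alpha>" if "x \<epsilon> lev r b" for x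
        using definable_subset_self[OF tr that] lev_suc 2 by simp
      have "y \<epsilon> lev r \<alpha>" if "x \<epsilon> lev r \<alpha>" "y \<epsilon> x" for x y
        using that definable_subset_subset[of r "lev r b" x] sub lev_suc 2 by auto
      moreover have "x \<epsilon> lev r \<alpha>" if "\<beta> \<epsilon> \<alpha>" "x \<epsilon> lev r \<beta>" "ordinal \<beta>" for \<beta> x
      proof (cases "\<beta> = b")
        case False
        then have "\<beta> \<epsilon> b" using 2(1) that(1) by simp
        then show ?thesis using IH[of b] 2 that sub by blast
      qed (use that sub in simp)
      ultimately show ?thesis using \<alpha> by blast
    next
      case 3
      have "y \<epsilon> lev r \<alpha>" if x: "x \<epsilon> lev r \<alpha>" "y \<epsilon> x" for x y
      proof -
        obtain \<gamma> where \<gamma>: "\<gamma> \<epsilon> \<alpha>" "x \<epsilon> lev r \<gamma>" using x lev_limit[OF 3] by blast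
        then have "y \<epsilon> lev r \<gamma>" using IH[OF \<gamma>(1)] x(2) ordinal_mem[OF \<alpha>] by blast
        with \<gamma>(1) show ?thesis using lev_limit[OF 3] by blast
      qed
      then show ?thesis using \<alpha> lev_limit[OF 3] by blast
    qed
  qed
  then show ?thesis using assms ordinal_mem[OF assms] by blast
qed

lemma trans_class_lev: "ordinal \<alpha> \<Longrightarrow> trans_class (ext (lev r \<alpha>))"
  unfolding trans_class_def using lev_properties by auto

lemma lev_mono: "ordinal \<alpha> \<Longrightarrow> \<beta> \<epsilon> \<alpha> \<Longrightarrow> x \<epsilon> lev r \<beta> \<Longrightarrow> x \<epsilon> lev r \<alpha>"
  using lev_properties by blast

lemma L_mem: "x \<in> L r \<Longrightarrow> y \<epsilon> x \<Longrightarrow> y \<in> L r"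
  unfolding L_iff using lev_properties by blast

lemma trans_class_L: "trans_class (L r)"
  unfolding trans_class_def using L_mem by auto

text \<open>Each element is sent to the least level containing it; replacement collects these
  indices, and any ordinal above them all is a bound.\<close>

lemma L_bounded:
  assumes "is_set S" "S \<subseteq> L r"
  shows "\<exists>\<alpha>. ordinal \<alpha> \<and> S \<subseteq> ext (lev r \<alpha>)"
proof -
  let ?in = "\<lambda>z \<alpha>. ordinal \<alpha> \<and> z \<epsilon> lev r \<alpha>"
  let ?Q = "\<lambda>z \<alpha>. ordinal \<alpha> \<and> ?in z \<alpha> \<and> (\<forall>k. k \<epsilon> \<alpha> \<longrightarrow> \<not> ?in z k)"
  let ?T = "{\<alpha>. \<exists>z. z \<epsilon> mk S \<and> ?Q z \<alpha>}"
  have Q: "\<exists>!\<alpha>. ?Q z \<alpha>" if z: "z \<in> L r" for z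
  proof -
    obtain \<alpha> where \<alpha>: "ordinal \<alpha>" "z \<epsilon> lev r \<alpha>" using z L_iff by blast
    have "dfv (\<lambda>\<rho>. ?in z (\<rho> 0))" by (intro dfb_lev dfv_intros)
    from ordinal_least[OF this \<alpha>(1)] \<alpha> show ?thesis by blast
  qed
  have T: "is_set ?T"
  proof (rule is_set_replace)
    show "dfv (\<lambda>\<rho>. ?Q (\<rho> 0) (\<rho> 1))"
      by (intro dfb_lev dfb_conj dfb_not dfb_all_in dfb_mem dfb_ordinal trm_var)
    show "\<exists>!\<alpha>. ?Q z \<alpha>" if "z \<epsilon> mk S" for z
      by (rule Q) (use that assms in auto)
  qed
  have "ext (mk ?T) = ?T" by (rule ext_mk[OF T])
  \<comment> \<open>Adding to the collected indices all their elements gives a downward closed set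
    of ordinals, hence an ordinal with every collected index below it.\<close>
  define U where "U = mk (\<Union>\<alpha>\<in>ext (mk ?T). ext \<alpha>)"
  define \<delta> where "\<delta> = mk (ext (mk ?T) \<union> ext U)"
  have \<delta>: "\<beta> \<epsilon> \<delta> \<longleftrightarrow> \<beta> \<epsilon> mk ?T \<or> \<beta> \<epsilon> U" for \<beta> by (simp add: \<delta>_def)
  have U: "\<beta> \<epsilon> U \<longleftrightarrow> (\<exists>\<alpha>. \<alpha> \<epsilon> mk ?T \<and> \<beta> \<epsilon> \<alpha>)" for \<beta> by (simp add: U_def)
  have o: "ordinal \<alpha>" if "\<alpha> \<epsilon> mk ?T" for \<alpha> using that T by auto
  have "ordinal \<delta>"
  proof (rule ordinalI)
    show "ordinal b" if "b \<epsilon> \<delta>" for b using that o ordinal_mem unfolding \<delta> U by blast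
    show "c \<epsilon> \<delta>" if "b \<epsilon> \<delta>" "c \<epsilon> b" for b c
      using that o ordinal_trans unfolding \<delta> U by blast
  qed
  moreover have "z \<epsilon> lev r \<delta>" if z: "z \<in> S" for z
  proof -
    obtain \<alpha> where \<alpha>: "?Q z \<alpha>" using Q z assms(2) by blast
    then have "\<alpha> \<epsilon> mk ?T" using T z assms(1) by auto
    then have "\<alpha> \<epsilon> \<delta>" using \<delta> by blast
    then show ?thesis using lev_mono[OF \<open>ordinal \<delta>\<close>] \<alpha> by blast
  qed
  ultimately show ?thesis by auto
qed

text \<open>
  Comprehension for conditions that are absolute between transitive classes: no reflection is
  needed, because a sufficiently high level of the hierarchy evaluates the condition correctly.
\<close>

lemma L_comprehension:
  assumes C: "finite C" "C \<subseteq> L r" and Q: "\<And>D. dfb C D (\<lambda>\<rho>. Q (\<rho> 0))"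
    and x: "\<And>z. z \<in> L r \<Longrightarrow> Q z \<Longrightarrow> z \<epsilon> x"
  obtains y where "y \<in> L r" "\<And>z. z \<epsilon> y \<longleftrightarrow> z \<in> L r \<and> Q z"
proof -
  have "dfv (\<lambda>\<rho>. \<rho> 0 \<in> L r \<and> Q (\<rho> 0))"
    by (intro dfb_conj dfb_L trm_var dfb_mono[OF Q]) simp
  then have "is_set {z. z \<in> L r \<and> Q z}" by (rule is_set_sep) (use x in blast)
  \<comment> \<open>The level must contain the parameters as well as the solutions, so that the
    condition can be evaluated over it.\<close>
  then have "is_set (C \<union> {z. z \<in> L r \<and> Q z})" using is_set_finite[OF C(1)] by simp
  then obtain \<alpha> where \<alpha>: "ordinal \<alpha>" "C \<union> {z. z \<in> L r \<and> Q z} \<subseteq> ext (lev r \<alpha>)"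
    using L_bounded C(2) by (metis (no_types, lifting) Un_least mem_Collect_eq subsetI)
  let ?A = "lev r \<alpha>"
  have "dfv (\<lambda>\<rho>. \<rho> 0 \<epsilon> ?A \<and> Q (\<rho> 0))"
    by (intro dfv_intros dfb_mono[OF Q]) simp
  then have y: "is_set {z. z \<epsilon> ?A \<and> Q z}" by (rule is_set_sep) blast
  define y where "y = mk {z. z \<epsilon> ?A \<and> Q z}"
  have ey: "ext y = {z. z \<epsilon> ?A \<and> Q z}" unfolding y_def using y by (rule ext_mk)
  have "definable_subset r ?A y"
    by (rule definable_subset_dfb[OF _ trans_class_lev[OF \<alpha>(1)] ey]) (use \<alpha>(2) in \<open>intro dfb_mono[OF Q], blast\<close>)
  then have "y \<epsilon> lev r (suc \<alpha>)" using lev_suc \<alpha>(1) by blast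
  then have "y \<in> L r" using L_iff ordinal_suc \<alpha>(1) by blast
  moreover have "z \<epsilon> y \<longleftrightarrow> z \<in> L r \<and> Q z" for z
  proof -
    have "z \<epsilon> y \<longleftrightarrow> z \<epsilon> ?A \<and> Q z" using ey in_ext by blast
    moreover have "z \<in> L r" if "z \<epsilon> ?A" using that \<alpha>(1) L_iff by blast
    moreover have "z \<epsilon> ?A" if "z \<in> L r" "Q z" using that \<alpha>(2) in_ext by blast
    ultimately show ?thesis by blast
  qed
  ultimately show ?thesis using that by blast
qed


subsection \<open>Generic filters for countably many dense sets\<close>

text \<open>Since \<open>h\<close> is only an injection into the naturals, \<open>k\<close> may
  number no set or one that is not dense; then \<open>u\<close> itself is a candidate.\<close>

definition candidate :: "'a \<Rightarrow> 'a \<Rightarrow> 'a \<Rightarrow> 'a \<Rightarrow> 'a \<Rightarrow> 'a \<Rightarrow> bool" where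
  "candidate P le h k u v \<longleftrightarrow> v \<epsilon> P \<and> rel le v u \<and> (\<forall>D. rel h D k \<longrightarrow> dense P le D \<longrightarrow> v \<epsilon> D)"

text \<open>
  The enumeration \<open>h\<close> of the dense sets and the enumeration \<open>g\<close> of \<open>P\<close>, both injections into the
  natural numbers, make the choice of the next condition definable.
\<close>

definition next_condition :: "'a \<Rightarrow> 'a \<Rightarrow> 'a \<Rightarrow> 'a \<Rightarrow> 'a \<Rightarrow> 'a \<Rightarrow> 'a \<Rightarrow> bool" where
  "next_condition P le g h k u v \<longleftrightarrow> candidate P le h k u v \<and>
     (\<forall>w m n. candidate P le h k u w \<longrightarrow> rel g v m \<longrightarrow> rel g w n \<longrightarrow> \<not> n \<epsilon> m)"

text \<open>\<open>emp\<close> for \<open>u\<close> outside \<open>P\<close>, and \<open>q\<close>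
  at limits, are defaults that make the step total on all ordinals, as the recursion theorem
  demands.\<close>

definition descent_step :: "'a \<Rightarrow> 'a \<Rightarrow> 'a \<Rightarrow> 'a \<Rightarrow> 'a \<Rightarrow> 'a \<Rightarrow> 'a \<Rightarrow> 'a \<Rightarrow> bool" where
  "descent_step P le g h q f \<beta> v \<longleftrightarrow>
     (\<forall>k u. is_succ \<beta> k \<longrightarrow> rel f k u \<longrightarrow>
        (u \<epsilon> P \<longrightarrow> next_condition P le g h k u v) \<and> (\<not> u \<epsilon> P \<longrightarrow> v = emp)) \<and>
     ((\<forall>k. \<not> is_succ \<beta> k) \<longrightarrow> v = q)"

lemma dfb_dense: "trm UNIV t \<Longrightarrow> trm UNIV u \<Longrightarrow> trm UNIV v \<Longrightarrow> dfv (\<lambda>\<rho>. dense (t \<rho>) (u \<rho>) (v \<rho>))"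
  by (rule dfb_subst3[where P = dense]) (unfold dense_def, intro dfv_intros)

lemma dfb_candidate:
  "trm UNIV k \<Longrightarrow> trm UNIV u \<Longrightarrow> trm UNIV v \<Longrightarrow> dfv (\<lambda>\<rho>. candidate P le h (k \<rho>) (u \<rho>) (v \<rho>))"
  by (rule dfb_subst3[where P = "candidate P le h"]) (unfold candidate_def, intro dfv_intros dfb_dense)

lemma dfb_next_condition:
  "trm UNIV k \<Longrightarrow> trm UNIV u \<Longrightarrow> trm UNIV v \<Longrightarrow> dfv (\<lambda>\<rho>. next_condition P le g h (k \<rho>) (u \<rho>) (v \<rho>))"
  by (rule dfb_subst3[where P = "next_condition P le g h"])
    (unfold next_condition_def, intro dfv_intros dfb_candidate)

lemma dfb_descent_step: "dfv (\<lambda>\<rho>. descent_step P le g h q (\<rho> 0) (\<rho> 1) (\<rho> 2))"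
  unfolding descent_step_def by (intro dfv_intros dfb_next_condition)

text \<open>The Rasiowa-Sikorski argument carried out inside the model, with \<open>y\<close> as the
  power set of the carrier in \<open>M\<close>.\<close>

lemma countable_generic:
  assumes po: "is_partial_order P le" and P: "countable P" and Y: "countable y"
    and y: "\<And>D. D \<epsilon> y \<longleftrightarrow> D \<in> M \<and> ext D \<subseteq> ext P"
  shows "\<exists>G. generic M P le G"
proof -
  have le_P: "a \<epsilon> P \<and> b \<epsilon> P" if "rel le a b" for a b
    using po that unfolding is_partial_order_def rel_def by (metis is_opair_iff opr_inject)
  have refl: "rel le a a" if "a \<epsilon> P" for a using po that unfolding is_partial_order_def by blast
  have trans: "rel le a c" if "rel le a b" "rel le b c" for a b c
    using po that unfolding is_partial_order_def by blast
  obtain q where q: "q \<epsilon> P"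
    using po ext_inject[of P emp] unfolding is_partial_order_def by auto
  obtain g where g: "is_function g (ext P) Omega" "\<And>a b c. rel g a c \<Longrightarrow> rel g b c \<Longrightarrow> a = b"
    using P unfolding countable_def by blast
  obtain h where h: "is_function h (ext y) Omega" "\<And>a b c. rel h a c \<Longrightarrow> rel h b c \<Longrightarrow> a = b"
    using Y unfolding countable_def by blast
  have g1: "\<exists>!n. rel g a n" if "a \<epsilon> P" for a using g(1) that unfolding is_function_def by simp
  have gO: "n \<in> Omega" if "rel g a n" for a n
    using g(1) that unfolding is_function_iff rel_iff by fastforce
  have h1: "\<exists>k. rel h D k \<and> k \<in> Omega" if D: "D \<epsilon> y" for D
  proof -
    obtain k where k: "rel h D k" using h(1) D unfolding is_function_def Ball_ext by blast
    then have "k \<in> Omega" using h(1) unfolding is_function_iff rel_iff by fastforce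
    with k show ?thesis by blast
  qed
  let ?C = "candidate P le h" and ?N = "next_condition P le g h" and ?\<Phi> = "descent_step P le g h q"
  have candidate: "\<exists>v. ?C k u v" if u: "u \<epsilon> P" for k u
  proof (cases "\<exists>D. rel h D k \<and> dense P le D")
    case True
    then obtain D where D: "rel h D k" "dense P le D" by blast
    then obtain v where "v \<epsilon> D" "rel le v u" using u unfolding dense_def by blast
    moreover have "D' = D" if "rel h D' k" for D' using h(2) that D(1) by blast
    ultimately show ?thesis unfolding candidate_def using le_P by blast
  next
    case False
    then show ?thesis unfolding candidate_def using u refl by blast
  qed
  have "\<exists>!v. ?N k u v" if u: "u \<epsilon> P" for k u
  proof -
    obtain v n where v: "?C k u v" "rel g v n" using candidate[OF u] g1 unfolding candidate_def by metis
    \<comment> \<open>The next condition is the candidate with the least number under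
      \<open>g\<close>; injectivity of \<open>g\<close> makes it unique.\<close>
    let ?Q = "\<lambda>n. \<exists>v. ?C k u v \<and> rel g v n"
    have "dfv (\<lambda>\<rho>. ?Q (\<rho> 0))" by (intro dfv_intros dfb_candidate)
    then have "\<exists>!m. ordinal m \<and> ?Q m \<and> (\<forall>k. k \<epsilon> m \<longrightarrow> \<not> ?Q k)"
      by (rule ordinal_least[where Q = ?Q and a = n]) (use v gO Omega_ordinal in blast)+
    then obtain m where m: "ordinal m" "?Q m" "\<And>k. k \<epsilon> m \<Longrightarrow> \<not> ?Q k" by blast
    then obtain w where w: "?C k u w" "rel g w m" by blast
    have gw: "rel g w m' \<longleftrightarrow> m' = m" for m' using w g1 unfolding candidate_def by blast
    have "?N k u w" unfolding next_condition_def gw using w(1) m(3) by blast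
    moreover have "w' = w" if w': "?N k u w'" for w'
    proof -
      have C': "?C k u w'" using w' unfolding next_condition_def by blast
      then obtain m' where m': "rel g w' m'" using g1 unfolding candidate_def by blast
      have "\<not> m \<epsilon> m'" using w' w m' unfolding next_condition_def by blast
      moreover have "\<not> m' \<epsilon> m" using m(3) C' m' by blast
      ultimately have "m' = m" using ordinal_linear m(1) gO[OF m'] Omega_ordinal by blast
      then show ?thesis using g(2) m' w(2) by blast
    qed
    ultimately show ?thesis by blast
  qed
  note N1 = this
  have step: "step_relation ?\<Phi>"
    unfolding step_relation_def
  proof (intro conjI allI impI dfb_descent_step)
    fix f \<beta> assume \<beta>: "ordinal \<beta>" and f: "\<forall>\<gamma>. \<gamma> \<epsilon> \<beta> \<longrightarrow> (\<exists>!u. rel f \<gamma> u)"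
    show "\<exists>!v. ?\<Phi> f \<beta> v"
    proof (cases "\<exists>k. is_succ \<beta> k")
      case True
      then obtain k where k: "\<beta> = suc k" by auto
      then obtain u where u: "rel f k v \<longleftrightarrow> v = u" for v using f by (metis mem_suc)
      have "?\<Phi> f \<beta> v \<longleftrightarrow> (u \<epsilon> P \<longrightarrow> ?N k u v) \<and> (\<not> u \<epsilon> P \<longrightarrow> v = emp)" for v
        unfolding descent_step_def k using u by simp
      then show ?thesis using N1[of u k] by (cases "u \<epsilon> P") simp_all
    next
      case False
      then show ?thesis unfolding descent_step_def by auto
    qed
  next
    fix f f' \<beta> v assume "\<forall>\<gamma> u. \<gamma> \<epsilon> \<beta> \<longrightarrow> rel f \<gamma> u = rel f' \<gamma> u" "?\<Phi> f \<beta> v"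
    then show "?\<Phi> f' \<beta> v" unfolding descent_step_def is_succ_iff by (metis mem_suc)
  qed
  define p where "p n = (THE v. rec ?\<Phi> n v)" for n
  have rec: "rec ?\<Phi> n v \<longleftrightarrow> v = p n" if "ordinal n" for n v
    using rec_ex1[OF step that] unfolding p_def by (metis theI')
  have p_step: "\<exists>f. ?\<Phi> f n (p n) \<and> (\<forall>k u. k \<epsilon> n \<longrightarrow> (rel f k u \<longleftrightarrow> u = p k))" if n: "ordinal n" for n
  proof -
    obtain f where f: "?\<Phi> f n (p n)" "\<And>k u. k \<epsilon> n \<Longrightarrow> rel f k u \<longleftrightarrow> rec ?\<Phi> k u"
      using rec_unfold[OF step, of n "p n"] rec[OF n] by blast
    then show ?thesis using rec ordinal_mem[OF n] by blast
  qed
  have p_emp: "p emp = q"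
    using p_step[OF ordinal_emp] unfolding descent_step_def by auto
  have p_suc: "?N n (p n) (p (suc n))" if "n \<in> Omega" "p n \<epsilon> P" for n
    using p_step[OF ordinal_suc[OF Omega_ordinal[OF that(1)]]] that(2) unfolding descent_step_def by auto
  have p_P: "p n \<epsilon> P" if "n \<in> Omega" for n
  proof -
    \<comment> \<open>Stated with \<open>rec\<close> instead of the HOL function \<open>p\<close>,
      because internal induction needs a condition given by a formula.\<close>
    have "\<forall>v. rec ?\<Phi> n v \<longrightarrow> v \<epsilon> P"
    proof (rule Omega_induct[where Q = "\<lambda>n. \<forall>v. rec ?\<Phi> n v \<longrightarrow> v \<epsilon> P", OF _ _ _ that])
      show "dfv (\<lambda>\<rho>. \<forall>v. rec ?\<Phi> (\<rho> 0) v \<longrightarrow> v \<epsilon> P)" by (intro dfv_intros dfb_rec[OF step])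
      show "\<forall>v. rec ?\<Phi> emp v \<longrightarrow> v \<epsilon> P" using rec p_emp q by simp
      fix n assume n: "n \<in> Omega" and IH: "\<forall>v. rec ?\<Phi> n v \<longrightarrow> v \<epsilon> P"
      then have "p n \<epsilon> P" using rec Omega_ordinal by blast
      then have "p (suc n) \<epsilon> P" using p_suc[OF n] unfolding next_condition_def candidate_def by blast
      then show "\<forall>v. rec ?\<Phi> (suc n) v \<longrightarrow> v \<epsilon> P" using rec n Omega_suc Omega_ordinal by simp
    qed
    then show ?thesis using rec that Omega_ordinal by blast
  qed
  have p_le: "rel le (p n) (p m)" if "m = n \<or> m \<epsilon> n" "n \<in> Omega" for m n
  proof -
    let ?Q = "\<lambda>n. \<forall>m u v. m = n \<or> m \<epsilon> n \<longrightarrow> rec ?\<Phi> m u \<longrightarrow> rec ?\<Phi> n v \<longrightarrow> rel le v u"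
    have "?Q n"
    proof (rule Omega_induct[where Q = ?Q, OF _ _ _ that(2)])
      show "dfv (\<lambda>\<rho>. ?Q (\<rho> 0))" by (intro dfv_intros dfb_rec[OF step])
      show "?Q emp" using rec p_emp q refl by simp
      fix n assume n: "n \<in> Omega" and IH: "?Q n"
      show "?Q (suc n)"
      proof (intro allI impI)
        fix m u v assume m: "m = suc n \<or> m \<epsilon> suc n" "rec ?\<Phi> m u" "rec ?\<Phi> (suc n) v"
        have v: "v = p (suc n)" using m(3) rec n Omega_suc Omega_ordinal by blast
        have le: "rel le (p (suc n)) (p n)"
          using p_suc[OF n p_P[OF n]] unfolding next_condition_def candidate_def by blast
        show "rel le v u"
        proof (cases "m = suc n")
          case True
          then have "u = v" using m v rec n Omega_suc Omega_ordinal by blast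
          then show ?thesis using v refl p_P n Omega_suc by blast
        next
          case False
          then have "m = n \<or> m \<epsilon> n" using m(1) by simp
          then have "rel le (p n) u" using IH m(2) rec n Omega_ordinal by blast
          then show ?thesis using trans le v by blast
        qed
      qed
    qed
    moreover have "ordinal m" "ordinal n" using that Omega_ordinal ordinal_mem by blast+
    ultimately show ?thesis using rec that(1) by blast
  qed
  \<comment> \<open>The upward closure of the descending sequence.\<close>
  let ?G = "{a. a \<epsilon> P \<and> (\<exists>n v. n \<in> Omega \<and> rec ?\<Phi> n v \<and> rel le v a)}"
  have "dfv (\<lambda>\<rho>. \<rho> 0 \<epsilon> P \<and> (\<exists>n v. n \<in> Omega \<and> rec ?\<Phi> n v \<and> rel le v (\<rho> 0)))"
    by (intro dfv_intros dfb_rec[OF step])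
  then have "is_set ?G" by (rule is_set_sep) blast
  then obtain G where "ext G = ?G" unfolding is_set_def by blast
  then have G: "a \<epsilon> G \<longleftrightarrow> (\<exists>n. n \<in> Omega \<and> rel le (p n) a)" for a
  proof -
    have "a \<epsilon> G \<longleftrightarrow> a \<in> ext G" by simp
    also have "\<dots> \<longleftrightarrow> (\<exists>n. n \<in> Omega \<and> rel le (p n) a)"
      unfolding \<open>ext G = ?G\<close> using rec Omega_ordinal le_P by auto
    finally show ?thesis .
  qed
  have p_G: "p n \<epsilon> G" if "n \<in> Omega" for n using G refl p_P that by blast
  have "filter P le G" unfolding filter_def
  proof (intro conjI allI impI)
    show "ext G \<subseteq> ext P" using G le_P by auto
    show "\<not> is_empty G" using p_G[OF Omega_emp] by auto
    show "b \<epsilon> G" if "a \<epsilon> G" "rel le a b" for a b using that G trans by blast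
    fix a b assume "a \<epsilon> G" "b \<epsilon> G"
    then obtain m n where mn: "m \<in> Omega" "rel le (p m) a" "n \<in> Omega" "rel le (p n) b" using G by blast
    show "\<exists>s. s \<epsilon> G \<and> rel le s a \<and> rel le s b"
    proof (cases "m = n \<or> m \<epsilon> n")
      case True
      then show ?thesis using p_G p_le[OF True] mn trans by blast
    next
      case False
      then have "n \<epsilon> m" using ordinal_linear mn Omega_ordinal by blast
      then show ?thesis using p_G p_le[of n m] mn trans by blast
    qed
  qed
  moreover have "ext G \<inter> ext D \<noteq> {}" if D: "D \<in> M" "dense P le D" for D
  proof -
    have "D \<epsilon> y" using y D unfolding dense_def by blast
    then obtain k where k: "rel h D k" "k \<in> Omega" using h1 by blast
    \<comment> \<open>The dense set with number \<open>k\<close> is entered in the step from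
      \<open>k\<close> to its successor.\<close>
    then have "p (suc k) \<epsilon> D"
      using p_suc[OF k(2) p_P[OF k(2)]] D(2) unfolding next_condition_def candidate_def by blast
    then show ?thesis using p_G[OF Omega_suc[OF k(2)]] by auto
  qed
  ultimately show ?thesis unfolding generic_def by blast
qed

section \<open>From countability of definable sets to generic filters\<close>

lemma L_oprD: "opr a b \<in> L r \<Longrightarrow> a \<in> L r \<and> b \<in> L r"
proof -
  assume "opr a b \<in> L r"
  moreover have "mk {a, b} \<epsilon> opr a b" by (simp add: opr_def)
  ultimately have "mk {a, b} \<in> L r" by (rule L_mem)
  then show ?thesis using L_mem[of "mk {a, b}"] by simp
qed

text \<open>By transitivity all elements of both sets are in \<open>L r\<close>, so a defining
  condition that quantifies over \<open>L r\<close> alone determines a set uniquely.\<close>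

lemma L_ext_eqI:
  assumes "v \<in> L r" "y \<in> L r" "\<And>z. z \<in> L r \<Longrightarrow> z \<epsilon> v \<longleftrightarrow> z \<epsilon> y"
  shows "v = y"
proof -
  have "z \<epsilon> v \<longleftrightarrow> z \<epsilon> y" for z using assms(3)[of z] L_mem[OF assms(1)] L_mem[OF assms(2)] by blast
  then have "ext v = ext y" by (simp add: set_eq_iff)
  then show ?thesis by simp
qed

lemma IFS_if_countable:
  assumes "\<And>r x. absolutely_definable r \<Longrightarrow> definable_in (L r) x \<Longrightarrow> countable x"
  shows IFS
  unfolding IFS_def
proof (intro allI impI)
  fix r z P le
  assume r: "absolutely_definable r" and z: "definable_in (L r) z" "is_opair z P le"
    and po: "is_partial_order P le"
  have "opr P le \<in> L r" using z unfolding definable_in_def by simp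
  then have P: "P \<in> L r" and le: "le \<in> L r" using L_oprD by blast+
  have def_P: "definable_in (L r) P"
  \<comment> \<open>Only one parameter is wanted here, so \<open>z\<close> fills both places of the
    rule.\<close>
  proof (rule definable_in2[OF z(1) z(1) trans_class_L, where Q = "\<lambda>z _ v. \<exists>le\<in>L r. is_opair z v le"])
    show "dfb {} (L r) (\<lambda>\<rho>. \<exists>le\<in>L r. is_opair (\<rho> 0) (\<rho> 2) le)"
      by (intro dfb_delta0)
    show "(\<exists>le\<in>L r. is_opair z v le) \<longleftrightarrow> v = P" for v using z(2) le by auto
  qed (fact P)
  obtain y where y: "y \<in> L r" "\<And>d. d \<epsilon> y \<longleftrightarrow> d \<in> L r \<and> ext d \<subseteq> ext P"
  proof (rule L_comprehension[where C = "{P}" and Q = "\<lambda>d. ext d \<subseteq> ext P" and r = r])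
    show "dfb {P} D (\<lambda>\<rho>. ext (\<rho> 0) \<subseteq> ext P)" for D by (intro dfb_delta0) simp
    \<comment> \<open>The power set in the sense of \<open>V\<close> serves as the bound;
      comprehension keeps its members in \<open>L[r]\<close>.\<close>
    show "d \<epsilon> mk {z. ext z \<subseteq> ext P}" if "ext d \<subseteq> ext P" for d using that by simp
  qed (use P in auto)
  have "definable_in (L r) y"
  proof (rule definable_in2[OF def_P def_P trans_class_L,
        where Q = "\<lambda>P _ v. \<forall>d\<in>L r. d \<epsilon> v \<longleftrightarrow> ext d \<subseteq> ext P"])
    show "dfb {} (L r) (\<lambda>\<rho>. \<forall>d\<in>L r. d \<epsilon> \<rho> 2 \<longleftrightarrow> ext d \<subseteq> ext (\<rho> 0))"
      by (intro dfb_delta0)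
    show "(\<forall>d\<in>L r. d \<epsilon> v \<longleftrightarrow> ext d \<subseteq> ext P) \<longleftrightarrow> v = y" if "v \<in> L r" for v
      using L_ext_eqI[OF that y(1)] y(2) by blast
  qed (fact y(1))
  then show "\<exists>G. generic (L r) P le G"
    using countable_generic[OF po assms[OF r def_P] assms[OF r] y(2)] by blast
qed


subsection \<open>Collapsing a definable set\<close>

lemma emp_in_L: "emp \<in> L r"
proof -
  obtain y where y: "y \<in> L r" "\<And>z. z \<epsilon> y \<longleftrightarrow> z \<in> L r \<and> z \<noteq> z"
  proof (rule L_comprehension[where C = "{}" and Q = "\<lambda>z. z \<noteq> z" and r = r])
    show "dfb {} D (\<lambda>\<rho>. \<rho> 0 \<noteq> \<rho> 0)" for D by (intro dfb_delta0)
  qed auto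
  then have "ext y = ext emp" by auto
  then have "y = emp" by (simp only: ext_inject)
  with y(1) show ?thesis by simp
qed

lemma insert_in_L:
  assumes "a \<in> L r" "b \<in> L r"
  shows "mk (insert a (ext b)) \<in> L r"
proof -
  obtain y where y: "y \<in> L r" "\<And>z. z \<epsilon> y \<longleftrightarrow> z \<in> L r \<and> (z = a \<or> z \<epsilon> b)"
  proof (rule L_comprehension[where C = "{a, b}" and Q = "\<lambda>z. z = a \<or> z \<epsilon> b" and r = r])
    show "dfb {a, b} D (\<lambda>\<rho>. \<rho> 0 = a \<or> \<rho> 0 \<epsilon> b)" for D by (intro dfb_delta0) simp_all
    show "z \<epsilon> mk (insert a (ext b))" if "z = a \<or> z \<epsilon> b" for z using that by simp
  qed (use assms in auto)
  have "z \<epsilon> y \<longleftrightarrow> z = a \<or> z \<epsilon> b" for z using y(2)[of z] assms(1) L_mem[OF assms(2)] by blast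
  then have "ext y = insert a (ext b)" by (simp add: set_eq_iff)
  then have "mk (insert a (ext b)) = y" using mk_ext[of y] by simp
  with y(1) show ?thesis by simp
qed

lemma pair_in_L: "a \<in> L r \<Longrightarrow> b \<in> L r \<Longrightarrow> mk {a, b} \<in> L r"
  using insert_in_L[of a r "mk (insert b (ext emp))"] insert_in_L[OF _ emp_in_L, of b r] by simp

lemma opr_in_L: "a \<in> L r \<Longrightarrow> b \<in> L r \<Longrightarrow> opr a b \<in> L r"
  unfolding opr_def using pair_in_L[of a r a] by (simp add: pair_in_L)

text \<open>Induction inside the model also reaches the nonstandard naturals.\<close>

lemma Omega_in_L: "n \<in> Omega \<Longrightarrow> n \<in> L r"
proof (rule Omega_induct[where Q = "\<lambda>n. n \<in> L r"])
  show "dfv (\<lambda>\<rho>. \<rho> 0 \<in> L r)" by (intro dfb_L trm_var)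
  show "suc n \<in> L r" if "n \<in> L r" for n unfolding suc_def using insert_in_L that by blast
qed (simp_all add: emp_in_L)

lemma omega_in_L: "omega \<in> L r"
proof -
  obtain y where y: "y \<in> L r" "\<And>n. n \<epsilon> y \<longleftrightarrow> n \<in> L r \<and> n \<in> Omega"
  proof (rule L_comprehension[where C = "{}" and Q = "\<lambda>n. n \<in> Omega" and r = r])
    show "dfb {} D (\<lambda>\<rho>. \<rho> 0 \<in> Omega)" for D by (intro dfb_delta0)
    show "n \<epsilon> omega" if "n \<in> Omega" for n using that by simp
  qed auto
  then have "ext y = ext omega" using Omega_in_L by auto
  then have "y = omega" by (simp only: ext_inject)
  with y(1) show ?thesis by simp
qed

lemma definable_omega: "definable_in (L r) omega"
proof (rule definable_in0[where Q = "\<lambda>v. \<forall>n\<in>L r. n \<epsilon> v \<longleftrightarrow> n \<in> Omega", OF _ trans_class_L omega_in_L])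
  show "dfb {} (L r) (\<lambda>\<rho>. \<forall>n\<in>L r. n \<epsilon> \<rho> 0 \<longleftrightarrow> n \<in> Omega)" by (intro dfb_delta0)
  show "(\<forall>n\<in>L r. n \<epsilon> v \<longleftrightarrow> n \<in> Omega) \<longleftrightarrow> v = omega" if "v \<in> L r" for v
    using L_ext_eqI[OF that omega_in_L] by auto
qed

text \<open>
  The forcing conditions: partial functions from a natural number into \<open>x\<close>. Bounding the domain
  replaces finiteness.
\<close>

definition partial_enum :: "'a \<Rightarrow> 'a \<Rightarrow> 'a \<Rightarrow> bool" where
  "partial_enum w x s \<longleftrightarrow> (\<exists>n. n \<epsilon> w \<and>
     (\<forall>p. p \<epsilon> s \<longrightarrow> (\<exists>m. m \<epsilon> n \<and> (\<exists>a. a \<epsilon> x \<and> is_opair p m a))) \<and>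
     (\<forall>m. m \<epsilon> n \<longrightarrow> (\<forall>a. a \<epsilon> x \<longrightarrow> (\<forall>b. b \<epsilon> x \<longrightarrow> rel s m a \<longrightarrow> rel s m b \<longrightarrow> a = b))))"

text \<open>Taking \<open>w\<close> as an argument instead of naming the naturals keeps every
  quantifier bounded, so conditions mean the same in \<open>L[r]\<close> and in
  \<open>V\<close>.\<close>

lemma dfb_partial_enum:
  "trm C t \<Longrightarrow> trm C u \<Longrightarrow> trm C v \<Longrightarrow> dfb C D (\<lambda>\<rho>. partial_enum (t \<rho>) (u \<rho>) (v \<rho>))"
  by (rule dfb_subst3[where P = partial_enum]) (unfold partial_enum_def, intro dfb_delta0)

lemma partial_enum_iff: "partial_enum omega x s \<longleftrightarrow> (\<exists>n. n \<in> Omega \<and>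
    (\<forall>p. p \<epsilon> s \<longrightarrow> (\<exists>m a. m \<epsilon> n \<and> a \<epsilon> x \<and> p = opr m a)) \<and>
    (\<forall>m a b. rel s m a \<longrightarrow> rel s m b \<longrightarrow> a = b))"
proof -
  have "(\<forall>m. m \<epsilon> n \<longrightarrow> (\<forall>a. a \<epsilon> x \<longrightarrow> (\<forall>b. b \<epsilon> x \<longrightarrow> rel s m a \<longrightarrow> rel s m b \<longrightarrow> a = b))) \<longleftrightarrow>
      (\<forall>m a b. rel s m a \<longrightarrow> rel s m b \<longrightarrow> a = b)"
    if s: "\<forall>p. p \<epsilon> s \<longrightarrow> (\<exists>m a. m \<epsilon> n \<and> a \<epsilon> x \<and> p = opr m a)" for n
  proof -
    have "m \<epsilon> n \<and> a \<epsilon> x" if "rel s m a" for m a using s that unfolding rel_iff by fastforce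
    then show ?thesis by blast
  qed
  then show ?thesis
    unfolding partial_enum_def mem_omega is_opair_iff by (auto cong: conj_cong)
qed

lemma partial_enum_emp: "partial_enum omega x emp"
  unfolding partial_enum_iff by (rule exI[of _ emp]) (simp add: rel_iff)

lemma partial_enum_extend:
  assumes "partial_enum omega x s" "a \<epsilon> x"
  shows "\<exists>n. n \<in> Omega \<and> partial_enum omega x (mk (insert (opr n a) (ext s)))"
proof -
  obtain n where n: "n \<in> Omega" "\<And>p. p \<epsilon> s \<Longrightarrow> \<exists>m a. m \<epsilon> n \<and> a \<epsilon> x \<and> p = opr m a"
    "\<And>m a b. rel s m a \<Longrightarrow> rel s m b \<Longrightarrow> a = b" using assms(1) unfolding partial_enum_iff by blast
  let ?t = "mk (insert (opr n a) (ext s))"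
  have t: "p \<epsilon> ?t \<longleftrightarrow> p = opr n a \<or> p \<epsilon> s" for p by simp
  have no: "\<not> rel s n b" for b using n(2)[of "opr n b"] unfolding rel_iff by auto
  have rel_t: "rel ?t m b \<longleftrightarrow> m = n \<and> b = a \<or> rel s m b" for m b unfolding rel_iff t by auto
  have "partial_enum omega x ?t" unfolding partial_enum_iff
  proof (rule exI[of _ "suc n"], intro conjI allI impI)
    show "\<exists>m b. m \<epsilon> suc n \<and> b \<epsilon> x \<and> p = opr m b" if "p \<epsilon> ?t" for p
      using that n(2)[of p] assms(2) unfolding t mem_suc by blast
    show "b = c" if "rel ?t m b" "rel ?t m c" for m b c
      using that no n(3) unfolding rel_t by blast
  qed (simp add: n(1))
  with n(1) show ?thesis by blast
qed

lemma countable_if_IFS: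
  assumes IFS: IFS and r: "absolutely_definable r" and x: "definable_in (L r) x"
  shows "countable x"
proof -
  have x_L: "x \<in> L r" using x by (simp add: definable_in_def)
  obtain P where P: "P \<in> L r" "\<And>s. s \<epsilon> P \<longleftrightarrow> s \<in> L r \<and> partial_enum omega x s"
  proof -
    obtain q where q: "\<And>m a. m \<epsilon> omega \<Longrightarrow> a \<epsilon> x \<Longrightarrow> opr m a \<epsilon> q" using pair_bound by blast
    have bound: "s \<epsilon> mk {z. ext z \<subseteq> ext q}" if s: "partial_enum omega x s" for s
    proof -
      have "p \<epsilon> q" if "p \<epsilon> s" for p
        using s that q Omega_mem unfolding partial_enum_iff mem_omega by metis
      then have "ext s \<subseteq> ext q" by auto
      then show ?thesis by simp
    qed
    show ?thesis
    proof (rule L_comprehension[where C = "{omega, x}" and Q = "partial_enum omega x" and r = r])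
      show "dfb {omega, x} D (\<lambda>\<rho>. partial_enum omega x (\<rho> 0))" for D
        by (intro dfb_partial_enum trm_var trm_const) simp_all
    qed (use that omega_in_L x_L bound in blast)+
  qed
  \<comment> \<open>Stronger conditions are larger sets. Both components range over
    \<open>P\<close>, which keeps the condition bounded.\<close>
  let ?le = "\<lambda>P z. \<exists>s. s \<epsilon> P \<and> (\<exists>t. t \<epsilon> P \<and> is_opair z s t \<and> ext t \<subseteq> ext s)"
  obtain le where le: "le \<in> L r" "\<And>z. z \<epsilon> le \<longleftrightarrow> z \<in> L r \<and> ?le P z"
  proof -
    obtain q where q: "\<And>s t. s \<epsilon> P \<Longrightarrow> t \<epsilon> P \<Longrightarrow> opr s t \<epsilon> q" using pair_bound by blast
    show ?thesis
    proof (rule L_comprehension[where C = "{P}" and Q = "?le P" and r = r])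
      show "dfb {P} D (\<lambda>\<rho>. ?le P (\<rho> 0))" for D by (intro dfb_delta0) simp_all
      show "z \<epsilon> q" if "?le P z" for z using that q by auto
    qed (use that P in auto)
  qed
  \<comment> \<open>\<open>L[r]\<close> is closed under pairs, so restricting to \<open>L[r]\<close>
    loses no pair of conditions.\<close>
  have mem_le: "z \<epsilon> le \<longleftrightarrow> ?le P z" for z
    using le(2) opr_in_L P(2) by auto
  have rel_le: "rel le s t \<longleftrightarrow> s \<epsilon> P \<and> t \<epsilon> P \<and> ext t \<subseteq> ext s" for s t
    unfolding rel_iff mem_le by simp
  have def_P: "definable_in (L r) P"
  proof (rule definable_in2[OF definable_omega x trans_class_L,
        where Q = "\<lambda>w x v. \<forall>s\<in>L r. s \<epsilon> v \<longleftrightarrow> partial_enum w x s"])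
    show "dfb {} (L r) (\<lambda>\<rho>. \<forall>s\<in>L r. s \<epsilon> \<rho> 2 \<longleftrightarrow> partial_enum (\<rho> 0) (\<rho> 1) s)"
      by (intro dfb_delta0 dfb_partial_enum)
    show "(\<forall>s\<in>L r. s \<epsilon> v \<longleftrightarrow> partial_enum omega x s) \<longleftrightarrow> v = P" if "v \<in> L r" for v
      using L_ext_eqI[OF that P(1)] P(2) by blast
  qed (fact P(1))
  have def_le: "definable_in (L r) le"
  proof (rule definable_in2[OF def_P def_P trans_class_L,
        where Q = "\<lambda>P _ v. \<forall>z\<in>L r. z \<epsilon> v \<longleftrightarrow> ?le P z"])
    show "dfb {} (L r) (\<lambda>\<rho>. \<forall>z\<in>L r. z \<epsilon> \<rho> 2 \<longleftrightarrow> ?le (\<rho> 0) z)"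
      by (intro dfb_delta0)
    show "(\<forall>z\<in>L r. z \<epsilon> v \<longleftrightarrow> ?le P z) \<longleftrightarrow> v = le" if "v \<in> L r" for v
      using L_ext_eqI[OF that le(1)] le(2) by blast
  qed (fact le(1))
  have def_z: "definable_in (L r) (opr P le)"
  proof (rule definable_in2[OF def_P def_le trans_class_L, where Q = "\<lambda>P le v. is_opair v P le"])
    show "dfb {} (L r) (\<lambda>\<rho>. is_opair (\<rho> 2) (\<rho> 0) (\<rho> 1))"
      by (intro dfb_delta0)
  qed (use opr_in_L P(1) le(1) in auto)
  have "is_partial_order P le" unfolding is_partial_order_def
  proof (intro conjI allI impI)
    have "emp \<epsilon> P" using P(2) emp_in_L partial_enum_emp by blast
    then show "\<not> is_empty P" by auto
    show "s = t" if "rel le s t" "rel le t s" for s t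
    proof -
      have "ext s = ext t" using that unfolding rel_le by blast
      then show ?thesis by simp
    qed
  qed (use rel_le mem_le in auto)
  then obtain G where G: "generic (L r) P le G"
    using IFS r def_z unfolding IFS_def by (metis is_opair_iff)
  then have GP: "s \<epsilon> P" if "s \<epsilon> G" for s
    using that unfolding generic_def filter_def by auto
  \<comment> \<open>Two conditions in the filter have a common extension in it, and that extension
    is single-valued.\<close>
  have compatible: "a = b" if st: "s \<epsilon> G" "t \<epsilon> G" and a: "rel s m a" and b: "rel t m b" for s t m a b
  proof -
    obtain u where u: "u \<epsilon> G" "rel le u s" "rel le u t"
      using G st unfolding generic_def filter_def by blast
    then have "ext s \<subseteq> ext u" "ext t \<subseteq> ext u" using rel_le by blast+
    then have "rel u m a" "rel u m b" using a b unfolding rel_iff by auto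
    moreover have "partial_enum omega x u" using GP u(1) P(2) by blast
    ultimately show ?thesis unfolding partial_enum_iff by blast
  qed
  have hit: "\<exists>m s. m \<in> Omega \<and> s \<epsilon> G \<and> rel s m a" if a: "a \<epsilon> x" for a
  proof -
    have a_L: "a \<in> L r" using L_mem x_L a by blast
    \<comment> \<open>The conditions with \<open>a\<close> in their range. The parameter
      \<open>a\<close> need not be definable; membership of \<open>D\<close> in \<open>L[r]\<close>
      is all that genericity asks.\<close>
    obtain D where D: "D \<in> L r" "\<And>s. s \<epsilon> D \<longleftrightarrow> s \<in> L r \<and> s \<epsilon> P \<and> (\<exists>m. m \<epsilon> omega \<and> rel s m a)"
    proof (rule L_comprehension[where C = "{P, omega, a}" and r = r
          and Q = "\<lambda>s. s \<epsilon> P \<and> (\<exists>m. m \<epsilon> omega \<and> rel s m a)"])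
      show "dfb {P, omega, a} D (\<lambda>\<rho>. \<rho> 0 \<epsilon> P \<and> (\<exists>m. m \<epsilon> omega \<and> rel (\<rho> 0) m a))" for D
        by (intro dfb_delta0) simp_all
    qed (use P(1) omega_in_L a_L in auto)
    have "dense P le D" unfolding dense_def
    proof (intro conjI allI impI)
      show "ext D \<subseteq> ext P" using D(2) by auto
      fix s assume s: "s \<epsilon> P"
      then obtain n where n: "n \<in> Omega" "partial_enum omega x (mk (insert (opr n a) (ext s)))"
        using partial_enum_extend a P(2) by blast
      let ?t = "mk (insert (opr n a) (ext s))"
      have t_L: "?t \<in> L r" using insert_in_L opr_in_L Omega_in_L[OF n(1)] a_L s P(2) by blast
      then have t: "?t \<epsilon> P" using n(2) P(2) by blast
      have "rel ?t n a" by (simp add: rel_iff)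
      then have "?t \<epsilon> D" using D(2) t t_L n(1) mem_omega by blast
      moreover have "rel le ?t s" using t s by (auto simp: rel_le)
      ultimately show "\<exists>t. t \<epsilon> D \<and> rel le t s" by blast
    qed
    then have "ext G \<inter> ext D \<noteq> {}" using G D(1) unfolding generic_def by blast
    then obtain s where "s \<epsilon> G" "s \<epsilon> D" by auto
    then show ?thesis using D(2) mem_omega by blast
  qed
  let ?H = "\<lambda>a m. m \<in> Omega \<and> (\<exists>s. s \<epsilon> G \<and> rel s m a)"
  \<comment> \<open>Countability asks for an injection, so the partial surjection given by
    \<open>G\<close> is inverted by taking the least argument mapped to \<open>a\<close>.
    Injectivity is the single-valuedness shown as \<open>compatible\<close>.\<close>
  let ?F = "\<lambda>a m. a \<epsilon> x \<and> ordinal m \<and> ?H a m \<and> (\<forall>k. k \<epsilon> m \<longrightarrow> \<not> ?H a k)"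
  have "\<exists>f. (\<forall>a m. rel f a m \<longleftrightarrow> ?F a m) \<and> (\<forall>p. p \<epsilon> f \<longrightarrow> (\<exists>a m. ?F a m \<and> p = opr a m))"
  proof (rule ex_graph)
    show "dfv (\<lambda>\<rho>. ?F (\<rho> 0) (\<rho> 1))" by (intro dfv_intros)
    show "a \<epsilon> x \<and> m \<epsilon> omega" if "?F a m" for a m using that by simp
  qed
  then obtain f where f: "\<And>a m. rel f a m \<longleftrightarrow> ?F a m" "\<And>p. p \<epsilon> f \<Longrightarrow> \<exists>a m. ?F a m \<and> p = opr a m"
    by blast
  have "\<exists>!m. rel f a m" if a: "a \<epsilon> x" for a
  proof -
    obtain m where m: "?H a m" using hit[OF a] by blast
    have "dfv (\<lambda>\<rho>. ?H a (\<rho> 0))" by (intro dfv_intros)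
    from ordinal_least[where Q = "?H a", OF this _ m] show ?thesis
      unfolding f(1) using a m Omega_ordinal by simp
  qed
  then have "is_function f (ext x) Omega" unfolding is_function_iff using f(2) by fastforce
  moreover have "a = b" if "rel f a c" "rel f b c" for a b c
    using that compatible unfolding f(1) by blast
  ultimately show ?thesis unfolding countable_def by blast
qed

end

theorem theorem12:
  fixes mem :: "'a \<Rightarrow> 'a \<Rightarrow> bool"
  assumes "membership.ZFC mem"
  shows "membership.IFS mem \<longleftrightarrow>
    (\<forall>r. membership.absolutely_definable mem r \<longrightarrow>
      (\<forall>x. membership.definable_in mem (membership.L mem r) x \<longrightarrow> membership.countable mem x))"
proof -
  interpret zfc_model mem by unfold_locales (rule assms)
  show ?thesis using countable_if_IFS IFS_if_countable by blast
qed

end
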